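(* Assume A1 (the Hessian of $f$ is $L$-Lipschitz). By taking $m:=n$, the algorithm Zero-Order CNM (described in the context) needs at most $$\mathcal{O}\bigl(n^{3/2}\epsilon^{-3/2}\bigr)$$ function evaluations of $f(\cdot)$ to find a point $\bar x$ such that $\|\nabla f(\bar x)+\psi'(\bar x)\|\le\epsilon$, where $\psi'(\bar x)\in\partial\psi(\bar x)$.
   Context: Setting: $\|\cdot\|$ is the Euclidean norm for vectors and the spectral norm for matrices; $e_1,\dots,e_n$ is the standard basis of $\mathbb{R}^n$; $I$ is the identity matrix. $f:\mathbb{R}^n\to\mathbb{R}$ is twice continuously differentiable (possibly non-convex), $\psi:\mathbb{R}^n\to\mathbb{R}\cup\{+\infty\}$ is a simple proper, closed and convex function (possibly non-differentiable), $Q=\operatorname{dom}\psi$, $F=f+\psi$, and $F^\star=\inf_{x\in Q}F(x)>-\infty$. The problem is to minimize $F$ over $Q$. Assumption A1: $\|\nabla^2 f(y)-\nabla^2 f(x)\|\le L\|y-x\|$ for all $x,y\in\mathbb{R}^n$, where $L\ge 0$. Procedure ZeroOrderCubicSteps$(x,B,\sigma,m,\epsilon)$ ($x\in Q$, $B=B^\top\in\mathbb{R}^{n\times n}$, $\sigma>0$, $m\ge1$ an integer, $\epsilon>0$): Step 0: set $x_0:=x$, $t:=0$. Step 1: if $t=m$, stop and return $(x_t,\text{success})$. Step 2: with $h_g=\frac{1}{3^{1/3}}\bigl[\frac{\epsilon m}{\sigma n^{1/2}}\bigr]^{1/2}$ compute $g_t\in\mathbb{R}^n$ by $[g_t]^{(i)}=\frac{f(x_t+h_ge_i)-f(x_t-h_ge_i)}{2h_g}$,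 $i=1,\dots,n$. Step 3: with $M_{x_t,\sigma}(y)=f(x_t)+\langle g_t,y-x_t\rangle+\frac12\langle B(y-x_t),y-x_t\rangle+\frac{\sigma}{6}\|y-x_t\|^3$, compute $x_{t+1}$ as an approximate solution of $\min_{y\in Q}\{M_{x_t,\sigma}(y)+\psi(y)\}$ such that $M_{x_t,\sigma}(x_{t+1})+\psi(x_{t+1})\le F(x_t)$ and $\|\nabla M_{x_t,\sigma}(x_{t+1})+\psi'(x_{t+1})\|\le\frac{\sigma}{4}\|x_{t+1}-x_t\|^2$ for some $\psi'(x_{t+1})\in\partial\psi(x_{t+1})$, and (optionally, if $\psi$ is twice differentiable) such that $B+\sigma\|x_{t+1}-x_t\|I+\nabla^2\psi(x_{t+1})\succeq0$. Step 4: if $F(x_0)-F(x_{t+1})\ge\frac{\epsilon^{3/2}}{384\,\sigma^{1/2}}(t+1)$, set $t:=t+1$ and go to Step 1; otherwise stop and return $(x_{t+1},\text{halt})$. Algorithm Zero-Order CNM: Step 0: given $x_0\in Q$, $\tau_0>0$, $\epsilon>0$, an integer $m\ge1$, set $k:=0$. Step 1: set $\ell:=0$. Step 1.1: with $\sigma_{k,\ell}=2^4(2/3)^{1/3}(2^\ell\tau_k)m$ and $h_{k,\ell}=\Bigl[\frac{3^4\sigma_{k,\ell}^{3/2}\epsilon^{3/2}}{2^{14}\cdot192\,n^3(2^\ell\tau_k)^3}\Bigr]^{1/3}$, compute $B_{k,\ell}=\frac12(A_{k,\ell}+A_{k,\ell}^\top)$ where, with $h=h_{k,\ell}$, $[A_{k,\ell}]^{(i,j)}=\frac{f(x_k+he_i+he_j)-f(x_k+he_i)-f(x_k+he_j)+f(x_k)}{h^2}$,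 $i,j=1,\dots,n$. Step 1.2: set $(\hat x_{k,\ell},\alpha_{k,\ell})=$ ZeroOrderCubicSteps$(x_k,B_{k,\ell},\sigma_{k,\ell},m,\epsilon)$. Step 2: if $\alpha_{k,\ell}=\text{halt}$, set $\ell:=\ell+1$ and go to Step 1.1. Step 3: let $\ell_k$ be the current value of $\ell$; set $x_{k+1}=\hat x_{k,\ell_k}$, $\tau_{k+1}=\max\{\tau_0,2^{\ell_k-1}\tau_k\}$, $k:=k+1$, and go to Step 1.
   Formalization: The bound O(n^{3/2} ε^{-3/2}), with constant depending only on L, τ_0 and F(x_0)-F*, is claimed for ε ≤ n^{-1/3}; for larger ε an additive n² term is included, since the first Hessian estimate alone costs order n² evaluations. *)

theory Defs
  imports "HOL-Analysis.Analysis" "HOL-Library.Multiset"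
begin

section \<open>Composite problem: minimize F = f + psi over Q = dom psi\<close>

definition edom :: "('a \<Rightarrow> ereal) \<Rightarrow> 'a set" where
  "edom \<psi> = {x. \<psi> x < \<infinity>}"

definition eepigraph :: "('a \<Rightarrow> ereal) \<Rightarrow> ('a \<times> real) set" where
  "eepigraph \<psi> = {(x, r). \<psi> x \<le> ereal r}"

definition proper_closed_convex :: "('a::real_normed_vector \<Rightarrow> ereal) \<Rightarrow> bool" where
  "proper_closed_convex \<psi> \<longleftrightarrow>
     (\<forall>x. \<psi> x \<noteq> -\<infinity>) \<and> edom \<psi> \<noteq> {} \<and> closed (eepigraph \<psi>) \<and> convex (eepigraph \<psi>)"

definition subdiff :: "('a::real_inner \<Rightarrow> ereal) \<Rightarrow> 'a \<Rightarrow> 'a set" where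
  "subdiff \<psi> x =
     (if x \<in> edom \<psi> then {s. \<forall>y. \<psi> x + ereal (s \<bullet> (y - x)) \<le> \<psi> y} else {})"

definition objective :: "('a \<Rightarrow> real) \<Rightarrow> ('a \<Rightarrow> ereal) \<Rightarrow> 'a \<Rightarrow> ereal" where
  "objective f \<psi> x = ereal (f x) + \<psi> x"

definition opt_value :: "('a \<Rightarrow> real) \<Rightarrow> ('a \<Rightarrow> ereal) \<Rightarrow> ereal" where
  "opt_value f \<psi> = (INF x \<in> edom \<psi>. objective f \<psi> x)"

definition spectral_norm :: "real ^ 'n ^ 'm \<Rightarrow> real" where
  "spectral_norm A = onorm (\<lambda>v. A *v v)"


section \<open>Finite differences\<close>

definition fd_grad :: "(real ^ 'n \<Rightarrow> real) \<Rightarrow> real \<Rightarrow> real ^ 'n \<Rightarrow> real ^ 'n" where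
  "fd_grad f h x =
     (\<chi> i. (f (x + h *\<^sub>R axis i 1) - f (x - h *\<^sub>R axis i 1)) / (2 * h))"

definition fd_hess :: "(real ^ 'n \<Rightarrow> real) \<Rightarrow> real \<Rightarrow> real ^ 'n \<Rightarrow> real ^ 'n ^ 'n" where
  "fd_hess f h x =
     (\<chi> i j. (f (x + h *\<^sub>R axis i 1 + h *\<^sub>R axis j 1) - f (x + h *\<^sub>R axis i 1)
               - f (x + h *\<^sub>R axis j 1) + f x) / h ^ 2)"

definition sym_part :: "real ^ 'n ^ 'n \<Rightarrow> real ^ 'n ^ 'n" where
  "sym_part A = (1 / 2) *\<^sub>R (A + transpose A)"


section \<open>Procedure ZeroOrderCubicSteps\<close>

text \<open>The dimension \<open>n\<close> in the step sizes is \<open>CARD('n)\<close>; it is passed as a number.\<close>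

definition grad_step_size :: "nat \<Rightarrow> real \<Rightarrow> nat \<Rightarrow> real \<Rightarrow> real" where
  "grad_step_size n \<sigma> m \<epsilon> =
     1 / (3 powr (1 / 3)) * sqrt (\<epsilon> * real m / (\<sigma> * sqrt (real n)))"

definition cubic_model ::
    "(real ^ 'n \<Rightarrow> real) \<Rightarrow> real ^ 'n \<Rightarrow> real ^ 'n ^ 'n \<Rightarrow> real \<Rightarrow> real ^ 'n \<Rightarrow> real ^ 'n \<Rightarrow> real" where
  "cubic_model f g B \<sigma> x y =
     f x + g \<bullet> (y - x) + 1 / 2 * ((B *v (y - x)) \<bullet> (y - x)) + \<sigma> / 6 * norm (y - x) ^ 3"

text \<open>
  Admissible outputs \<open>y\<close> of one inner step at \<open>x\<close>. The subproblem is solved inexactly, so this is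
  a relation. The optional second-order condition is not imposed: runs that
  additionally satisfy it are among those described here.
\<close>

definition cubic_step ::
    "(real ^ 'n \<Rightarrow> real) \<Rightarrow> (real ^ 'n \<Rightarrow> ereal) \<Rightarrow> real ^ 'n ^ 'n \<Rightarrow> real \<Rightarrow> nat \<Rightarrow> real
      \<Rightarrow> real ^ 'n \<Rightarrow> real ^ 'n \<Rightarrow> bool" where
  "cubic_step f \<psi> B \<sigma> m \<epsilon> x y \<longleftrightarrow>
     (let g = fd_grad f (grad_step_size CARD('n) \<sigma> m \<epsilon>) x; M = cubic_model f g B \<sigma> x in
        y \<in> edom \<psi> \<and>
        ereal (M y) + \<psi> y \<le> objective f \<psi> x \<and>
        (\<exists>gM s. (GDERIV M y :> gM) \<and> s \<in> subdiff \<psi> y \<and>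
                norm (gM + s) \<le> \<sigma> / 4 * norm (y - x) ^ 2))"

definition sufficient_decrease ::
    "('a \<Rightarrow> real) \<Rightarrow> ('a \<Rightarrow> ereal) \<Rightarrow> real \<Rightarrow> real \<Rightarrow> 'a \<Rightarrow> nat \<Rightarrow> 'a \<Rightarrow> bool" where
  "sufficient_decrease f \<psi> \<sigma> \<epsilon> x0 t y \<longleftrightarrow>
     objective f \<psi> x0 - objective f \<psi> y \<ge> ereal (\<epsilon> powr (3 / 2) / (384 * sqrt \<sigma>) * real (t + 1))"

datatype outcome = Success | Halt

text \<open>
  \<open>cubic_steps f \<psi> x B \<sigma> m \<epsilon> y T \<alpha>\<close>: an execution of the procedure that performs exactly \<open>T\<close>
  inner steps, generating the points \<open>y 0, \<dots>, y T\<close>, and returns \<open>(y T, \<alpha>)\<close>.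
\<close>

definition cubic_steps ::
    "(real ^ 'n \<Rightarrow> real) \<Rightarrow> (real ^ 'n \<Rightarrow> ereal) \<Rightarrow> real ^ 'n \<Rightarrow> real ^ 'n ^ 'n \<Rightarrow> real \<Rightarrow> nat \<Rightarrow> real
      \<Rightarrow> (nat \<Rightarrow> real ^ 'n) \<Rightarrow> nat \<Rightarrow> outcome \<Rightarrow> bool" where
  "cubic_steps f \<psi> x B \<sigma> m \<epsilon> y T \<alpha> \<longleftrightarrow>
     y 0 = x \<and>
     (\<forall>t<T. cubic_step f \<psi> B \<sigma> m \<epsilon> (y t) (y (Suc t))) \<and>
     (case \<alpha> of
        Success \<Rightarrow> T = m \<and> (\<forall>t<T. sufficient_decrease f \<psi> \<sigma> \<epsilon> x t (y (Suc t)))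
      | Halt \<Rightarrow> (\<exists>t. T = Suc t \<and> T \<le> m \<and> \<not> sufficient_decrease f \<psi> \<sigma> \<epsilon> x t (y (Suc t)) \<and>
                     (\<forall>s<t. sufficient_decrease f \<psi> \<sigma> \<epsilon> x s (y (Suc s)))))"


section \<open>Algorithm Zero-Order CNM\<close>

definition reg_param :: "nat \<Rightarrow> real \<Rightarrow> real" where
  "reg_param m M = 2 ^ 4 * (2 / 3) powr (1 / 3) * M * real m"

definition hess_step_size :: "nat \<Rightarrow> real \<Rightarrow> real \<Rightarrow> real \<Rightarrow> real" where
  "hess_step_size n \<sigma> \<epsilon> M =
     (3 ^ 4 * \<sigma> powr (3 / 2) * \<epsilon> powr (3 / 2) / (2 ^ 14 * 192 * real n ^ 3 * M ^ 3)) powr (1 / 3)"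

text \<open>
  One call of the procedure, together with the state \<open>(x_k, tau_k, l)\<close> in which it is made.
  Here \<open>call_M\<close> below is \<open>2 ^ l * tau_k\<close>.
\<close>

record 'a cnm_call =
  call_x :: 'a
  call_tau :: real
  call_ell :: nat
  call_iter :: "nat \<Rightarrow> 'a"
  call_steps :: nat
  call_result :: outcome

definition call_M :: "'a cnm_call \<Rightarrow> real" where
  "call_M c = 2 ^ call_ell c * call_tau c"

definition call_sigma :: "nat \<Rightarrow> 'a cnm_call \<Rightarrow> real" where
  "call_sigma m c = reg_param m (call_M c)"

definition call_h :: "nat \<Rightarrow> real \<Rightarrow> (real ^ 'n) cnm_call \<Rightarrow> real" where
  "call_h m \<epsilon> c = hess_step_size CARD('n) (call_sigma m c) \<epsilon> (call_M c)"

definition valid_call ::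
    "(real ^ 'n \<Rightarrow> real) \<Rightarrow> (real ^ 'n \<Rightarrow> ereal) \<Rightarrow> nat \<Rightarrow> real \<Rightarrow> (real ^ 'n) cnm_call \<Rightarrow> bool" where
  "valid_call f \<psi> m \<epsilon> c \<longleftrightarrow>
     cubic_steps f \<psi> (call_x c) (sym_part (fd_hess f (call_h m \<epsilon> c) (call_x c))) (call_sigma m c) m \<epsilon>
       (call_iter c) (call_steps c) (call_result c)"

text \<open>
  A run is flattened to the sequence of all procedure calls, over all \<open>(k, l)\<close> in order. The
  algorithm has no stopping test, so the sequence is infinite, but \<open>k\<close> need not tend to infinity
  along it: once a stationary point has been met, all further trials for the current \<open>k\<close> may halt.
  Note \<open>2 powr (l - 1) = 2 ^ l / 2\<close>, which is \<open>1 / 2\<close> for \<open>l = 0\<close>.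
\<close>

definition cnm_run ::
    "(real ^ 'n \<Rightarrow> real) \<Rightarrow> (real ^ 'n \<Rightarrow> ereal) \<Rightarrow> real ^ 'n \<Rightarrow> real \<Rightarrow> nat \<Rightarrow> real
      \<Rightarrow> (nat \<Rightarrow> (real ^ 'n) cnm_call) \<Rightarrow> bool" where
  "cnm_run f \<psi> x0 \<tau>0 m \<epsilon> c \<longleftrightarrow>
     call_x (c 0) = x0 \<and> call_tau (c 0) = \<tau>0 \<and> call_ell (c 0) = 0 \<and>
     (\<forall>j. valid_call f \<psi> m \<epsilon> (c j)) \<and>
     (\<forall>j. case call_result (c j) of
        Halt \<Rightarrow>
          call_x (c (Suc j)) = call_x (c j) \<and>
          call_tau (c (Suc j)) = call_tau (c j) \<and>
          call_ell (c (Suc j)) = Suc (call_ell (c j))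
      | Success \<Rightarrow>
          call_x (c (Suc j)) = call_iter (c j) (call_steps (c j)) \<and>
          call_tau (c (Suc j)) = max \<tau>0 (2 ^ call_ell (c j) / 2 * call_tau (c j)) \<and>
          call_ell (c (Suc j)) = 0)"


section \<open>Function evaluations\<close>

text \<open>
  Queries of \<open>f\<close> are collected as multisets of arguments. No value is reused between two
  matrix entries, two gradient components or two inner steps, so any implementation that caches
  values makes at most this many evaluations.
\<close>

definition hess_queries :: "real \<Rightarrow> real ^ 'n \<Rightarrow> (real ^ 'n) multiset" where
  "hess_queries h x =
     (\<Sum>i\<in>UNIV. \<Sum>j\<in>UNIV.
        {# x + h *\<^sub>R axis i 1 + h *\<^sub>R axis j 1, x + h *\<^sub>R axis i 1, x + h *\<^sub>R axis j 1, x #})"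

definition grad_queries :: "real \<Rightarrow> real ^ 'n \<Rightarrow> (real ^ 'n) multiset" where
  "grad_queries h x = (\<Sum>i\<in>UNIV. {# x + h *\<^sub>R axis i 1, x - h *\<^sub>R axis i 1 #})"

text \<open>
  Besides the gradient estimate, an inner step from \<open>y t\<close> needs \<open>f (y t)\<close> (for the model and the
  bound \<open>F (y t)\<close>), and \<open>f (y 0)\<close> and \<open>f (y (t + 1))\<close> for the decrease test.
\<close>

definition call_queries :: "nat \<Rightarrow> real \<Rightarrow> (real ^ 'n) cnm_call \<Rightarrow> nat \<Rightarrow> (real ^ 'n) multiset" where
  "call_queries m \<epsilon> c T =
     hess_queries (call_h m \<epsilon> c) (call_x c) +
     (\<Sum>t<T. grad_queries (grad_step_size CARD('n) (call_sigma m c) m \<epsilon>) (call_iter c t) +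
        {# call_iter c t, call_iter c 0, call_iter c (Suc t) #})"

text \<open>Number of evaluations of \<open>f\<close> up to and including inner step number \<open>t\<close> of call \<open>j\<close>.\<close>

definition evals :: "nat \<Rightarrow> real \<Rightarrow> (nat \<Rightarrow> (real ^ 'n) cnm_call) \<Rightarrow> nat \<Rightarrow> nat \<Rightarrow> nat" where
  "evals m \<epsilon> c j t =
     size ((\<Sum>i<j. call_queries m \<epsilon> (c i) (call_steps (c i))) + call_queries m \<epsilon> (c j) t)"

text \<open>
  The constant of the complexity bound, a function of the Lipschitz constant \<open>L\<close>, the initial
  \<open>tau_0\<close> and the initial gap \<open>\<Delta> = F x0 - F*\<close>. It must not depend on the dimension, which is a type
  and hence cannot be quantified after the constant; therefore the constant is given explicitly.
\<close>

definition complexity_const :: "real \<Rightarrow> real \<Rightarrow> real \<Rightarrow> real" where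
  "complexity_const L \<tau>0 \<Delta> =
     40000 * sqrt (max \<tau>0 L) * \<Delta> + 18 + 9 * log 2 (max \<tau>0 L / \<tau>0)"

end

(*
  If the trial constant M = 2^l tau_k is at least L, then 13 L n <= sigma, and with s = sqrt (eps / sigma)
  the finite differences have errors at most sigma s^2 / 100 (gradient) and sigma s / 30 (Hessian).
  As long as no point of the call is eps-stationary, the stationarity residual of each cubic step bounds
  eps by a quadratic expression in the step lengths, so the steps are on average at least of order s;
  the lazy Hessian costs only a term L n sum r^3, which the cubic regularizer absorbs. Hence every
  test of the procedure is passed and the call succeeds. Therefore M never exceeds 2 max (tau_0, L), each
  success decreases F by at least a constant times sqrt n eps^(3/2), which bounds the number of successes,
  and halts are paid for by successes because M doubles at a halt and is at most halved at a success.
  Each call makes at most 9 n^2 evaluations.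
*)
theory Submission
  imports Defs
begin

section \<open>Norm estimates from entry bounds, and gradients of the cubic model\<close>

text \<open>Comparison with the constant vector \<open>b\<close>. The square root of the dimension
  lost here is the one that \<open>grad_step_size\<close> compensates.\<close>

lemma norm_le_sqrt_card:
  fixes v :: "real ^ 'n"
  assumes "\<And>i. \<bar>v $ i\<bar> \<le> b"
  shows "norm v \<le> sqrt (real CARD('n)) * b"
proof -
  have "0 \<le> b" using assms[of undefined] by linarith
  have "norm v \<le> norm (\<chi> i::'n. b)"
    using assms \<open>0 \<le> b\<close> by (intro norm_le_componentwise_cart) simp
  also have "\<dots> = sqrt (real CARD('n)) * b"
    using \<open>0 \<le> b\<close> by (simp add: norm_vec_def L2_set_def real_sqrt_mult)
  finally show ?thesis .
qed

text \<open>Cauchy-Schwarz in each row loses one square root of the dimension, and passing from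
  components to the norm loses another.\<close>

lemma norm_matrix_vector_le_entry_bound:
  fixes A :: "real ^ 'n ^ 'n"
  assumes "\<And>i j. \<bar>A $ i $ j\<bar> \<le> b"
  shows "norm (A *v v) \<le> real CARD('n) * b * norm v"
proof -
  have "\<bar>(A *v v) $ i\<bar> \<le> sqrt (real CARD('n)) * b * norm v" for i
  proof -
    have "\<bar>(A *v v) $ i\<bar> = \<bar>A $ i \<bullet> v\<bar>" by (simp add: matrix_vector_mul_component)
    also have "\<dots> \<le> norm (A $ i) * norm v" by (rule Cauchy_Schwarz_ineq2)
    also have "\<dots> \<le> sqrt (real CARD('n)) * b * norm v"
      by (intro mult_right_mono norm_le_sqrt_card assms) simp
    finally show ?thesis .
  qed
  then have "norm (A *v v) \<le> sqrt (real CARD('n)) * (sqrt (real CARD('n)) * b * norm v)"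
    by (rule norm_le_sqrt_card)
  then show ?thesis by (simp flip: mult.assoc)
qed

text \<open>\<open>cubic_step\<close> only says that some gradient \<open>gM\<close> of the model
  exists; uniqueness identifies it with the explicit formula of
  \<open>GDERIV_cubic_model\<close>.\<close>

lemma GDERIV_unique:
  assumes "GDERIV f x :> a" "GDERIV f x :> b"
  shows "a = b"
proof -
  have "(\<lambda>h. h \<bullet> a) = (\<lambda>h. h \<bullet> b)"
    using assms unfolding gderiv_def by (rule has_derivative_unique)
  then have "(a - b) \<bullet> a = (a - b) \<bullet> b" by meson
  then have "(a - b) \<bullet> (a - b) = 0" by (simp add: inner_diff_right)
  then show ?thesis by simp
qed

text \<open>Away from 0 this is the chain rule. At 0, where the norm is not differentiable, the
  difference quotient is \<open>norm h ^ 2\<close>, which tends to 0.\<close>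

lemma GDERIV_norm_cubed:
  fixes d :: "'a::real_inner"
  shows "GDERIV (\<lambda>d. norm d ^ 3) d :> (3 * norm d) *\<^sub>R d"
proof (cases "d = 0")
  case True
  have "((\<lambda>h::'a. norm h ^ 2) \<longlongrightarrow> 0) (at 0)"
    by (auto intro!: tendsto_eq_intros)
  moreover have "norm h ^ 2 = norm h ^ 3 / norm h" for h :: 'a
    by (simp add: power3_eq_cube power2_eq_square)
  ultimately show ?thesis
    using True by (simp add: gderiv_def has_derivative_at)
next
  case False
  show ?thesis
    unfolding gderiv_def
    by (rule derivative_eq_intros has_derivative_norm refl False | simp)+
       (use False in \<open>auto simp: fun_eq_iff sgn_div_norm power2_eq_square\<close>)
qed

lemma GDERIV_cubic_model:
  assumes "transpose B = B"
  shows "GDERIV (cubic_model f g B \<sigma> x) y :> g + B *v (y - x) + (\<sigma> / 2 * norm (y - x)) *\<^sub>R (y - x)"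
proof -
  have sym: "(B *v u) \<bullet> v = (B *v v) \<bullet> u" for u v
    by (metis assms dot_lmul_matrix inner_commute transpose_matrix_vector)
  have bl: "((\<lambda>y. B *v (y - x)) has_derivative (\<lambda>h. B *v h)) (at y)"
    by (rule has_derivative_eq_rhs, rule bounded_linear.has_derivative[OF matrix_vector_mul_bounded_linear])
       (auto intro!: derivative_eq_intros)
  have cub: "((\<lambda>y. norm (y - x) ^ 3) has_derivative (\<lambda>h. h \<bullet> ((3 * norm (y - x)) *\<^sub>R (y - x)))) (at y)"
    by (rule has_derivative_eq_rhs,
        rule has_derivative_compose[of "\<lambda>y. y - x" "\<lambda>h. h" y UNIV "\<lambda>d. norm d ^ 3",
              OF _ GDERIV_norm_cubed[unfolded gderiv_def]])
       (auto intro!: derivative_eq_intros)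
  have "(cubic_model f g B \<sigma> x has_derivative (\<lambda>h. g \<bullet> h
      + 1 / 2 * ((B *v (y - x)) \<bullet> h + (B *v h) \<bullet> (y - x))
      + \<sigma> / 6 * (h \<bullet> ((3 * norm (y - x)) *\<^sub>R (y - x))))) (at y)"
    unfolding cubic_model_def
    by (rule has_derivative_eq_rhs, (rule bl cub derivative_eq_intros refl)+) simp
  \<comment> \<open>By symmetry of \<open>B\<close> the two halves of the derivative of the
    quadratic form coincide.\<close>
  moreover have "g \<bullet> h + 1 / 2 * ((B *v (y - x)) \<bullet> h + (B *v h) \<bullet> (y - x))
      + \<sigma> / 6 * (h \<bullet> ((3 * norm (y - x)) *\<^sub>R (y - x)))
      = h \<bullet> (g + B *v (y - x) + (\<sigma> / 2 * norm (y - x)) *\<^sub>R (y - x))" for h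
    unfolding sym[of h "y - x"]
    by (simp only: inner_add_right inner_scaleR_right inner_commute[of h]) simp
  ultimately show ?thesis
    by (simp add: gderiv_def)
qed

section \<open>Taylor remainders and finite-difference errors for a Lipschitz Hessian\<close>

text \<open>The Lipschitz condition is stated through the action on vectors, as the estimates use
  it; the spectral norm enters only when the locale is interpreted.\<close>

locale lipschitz_hessian =
  fixes f :: "real ^ 'n \<Rightarrow> real"
    and grad :: "real ^ 'n \<Rightarrow> real ^ 'n"
    and hess :: "real ^ 'n \<Rightarrow> real ^ 'n ^ 'n"
    and L :: real
  assumes GDERIV_f: "GDERIV f x :> grad x"
    and has_derivative_grad: "(grad has_derivative (\<lambda>v. hess x *v v)) (at x)"
    and hess_lipschitz: "norm ((hess y - hess x) *v v) \<le> L * norm (y - x) * norm v"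
    and L_nonneg: "0 \<le> L"
begin

lemma has_vector_derivative_grad_line:
  "((\<lambda>t. grad (x + t *\<^sub>R d)) has_vector_derivative hess (x + t *\<^sub>R d) *v d) (at t)"
proof -
  have "((\<lambda>t. x + t *\<^sub>R d) has_derivative (\<lambda>h. h *\<^sub>R d)) (at t)"
    by (auto intro!: derivative_eq_intros)
  from has_derivative_compose[OF this has_derivative_grad]
  show ?thesis
    by (simp add: has_vector_derivative_def matrix_vector_mult_scaleR)
qed

lemma has_vector_derivative_f_line:
  "((\<lambda>t. f (x + t *\<^sub>R d)) has_vector_derivative grad (x + t *\<^sub>R d) \<bullet> d) (at t)"
proof -
  have "((\<lambda>t. x + t *\<^sub>R d) has_derivative (\<lambda>h. h *\<^sub>R d)) (at t)"
    by (auto intro!: derivative_eq_intros)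
  from has_derivative_compose[OF this GDERIV_f[unfolded gderiv_def]]
  show ?thesis
    by (simp add: has_vector_derivative_def inner_commute)
qed

text \<open>Mean value inequality with a scalar majorant \<open>q\<close>; it takes the place of
  integral remainders in the Taylor estimates below.\<close>

lemma line_bound:
  fixes p :: "real \<Rightarrow> 'b::real_normed_vector"
  assumes "\<And>t. (p has_vector_derivative p' t) (at t)"
    and "\<And>t. (q has_vector_derivative q' t) (at t)"
    and "\<And>t. 0 < t \<Longrightarrow> t < 1 \<Longrightarrow> norm (p' t) \<le> q' t"
  shows "norm (p 1 - p 0) \<le> q 1 - q 0"
  by (rule differentiable_bound_general)
     (use assms in \<open>auto intro!: continuous_at_imp_continuous_on has_vector_derivative_continuous\<close>)

lemma grad_taylor: "norm (grad (x + d) - grad x - hess x *v d) \<le> L / 2 * norm d ^ 2"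
proof -
  have "norm ((grad (x + 1 *\<^sub>R d) - 1 *\<^sub>R (hess x *v d)) - (grad (x + 0 *\<^sub>R d) - 0 *\<^sub>R (hess x *v d)))
      \<le> L / 2 * 1 ^ 2 * norm d ^ 2 - L / 2 * 0 ^ 2 * norm d ^ 2"
  proof (rule line_bound)
    show "((\<lambda>t. grad (x + t *\<^sub>R d) - t *\<^sub>R (hess x *v d)) has_vector_derivative
        hess (x + t *\<^sub>R d) *v d - hess x *v d) (at t)" for t
      by (rule derivative_eq_intros has_vector_derivative_grad_line refl | simp)+
    show "((\<lambda>t. L / 2 * t ^ 2 * norm d ^ 2) has_vector_derivative L * t * norm d ^ 2) (at t)" for t
      unfolding has_real_derivative_iff_has_vector_derivative[symmetric]
      by (auto intro!: derivative_eq_intros)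
    show "norm (hess (x + t *\<^sub>R d) *v d - hess x *v d) \<le> L * t * norm d ^ 2" if "0 < t" for t
      using hess_lipschitz[of "x + t *\<^sub>R d" x d] that
      by (simp add: matrix_vector_mult_diff_rdistrib power2_eq_square algebra_simps)
  qed
  then show ?thesis by (simp add: algebra_simps)
qed

text \<open>Along the segment, the derivative of the remainder is the remainder of
  \<open>grad_taylor\<close> for \<open>t *\<^sub>R d\<close>, paired with \<open>d\<close>.\<close>

lemma f_taylor:
  "\<bar>f (x + d) - f x - grad x \<bullet> d - 1 / 2 * ((hess x *v d) \<bullet> d)\<bar> \<le> L / 6 * norm d ^ 3"
proof -
  let ?p = "\<lambda>t. f (x + t *\<^sub>R d) - t * (grad x \<bullet> d) - t ^ 2 / 2 * ((hess x *v d) \<bullet> d)"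
  let ?q = "\<lambda>t. L / 6 * t ^ 3 * norm d ^ 3"
  have "norm (?p 1 - ?p 0) \<le> ?q 1 - ?q 0"
  proof (rule line_bound)
    show "(?p has_vector_derivative
        grad (x + t *\<^sub>R d) \<bullet> d - grad x \<bullet> d - t * ((hess x *v d) \<bullet> d)) (at t)" for t
      using has_vector_derivative_f_line[of x d t]
      unfolding has_real_derivative_iff_has_vector_derivative[symmetric]
      by (auto intro!: derivative_eq_intros)
    show "(?q has_vector_derivative L / 2 * t ^ 2 * norm d ^ 3) (at t)" for t
      unfolding has_real_derivative_iff_has_vector_derivative[symmetric]
      by (auto intro!: derivative_eq_intros)
    show "norm (grad (x + t *\<^sub>R d) \<bullet> d - grad x \<bullet> d - t * ((hess x *v d) \<bullet> d))
        \<le> L / 2 * t ^ 2 * norm d ^ 3" for t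
    proof -
      have "grad (x + t *\<^sub>R d) \<bullet> d - grad x \<bullet> d - t * ((hess x *v d) \<bullet> d) =
          (grad (x + t *\<^sub>R d) - grad x - hess x *v (t *\<^sub>R d)) \<bullet> d"
        by (simp add: matrix_vector_mult_scaleR algebra_simps)
      also have "norm \<dots> \<le> norm (grad (x + t *\<^sub>R d) - grad x - hess x *v (t *\<^sub>R d)) * norm d"
        by (rule Cauchy_Schwarz_ineq2[folded real_norm_def])
      also have "\<dots> \<le> L / 2 * norm (t *\<^sub>R d) ^ 2 * norm d"
        by (intro mult_right_mono grad_taylor) simp
      finally show ?thesis
        by (simp add: power_mult_distrib power2_eq_square power3_eq_cube algebra_simps)
    qed
  qed
  then show ?thesis by (simp add: algebra_simps)
qed

text \<open>Only \<open>u\<close> is traversed. The derivative splits into the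
  \<open>grad_taylor\<close> remainder for \<open>v\<close> at the moving point and the change of
  the Hessian along \<open>t *\<^sub>R u\<close>; these give the two terms of the bound.\<close>

lemma second_difference_bound:
  "\<bar>f (x + u + v) - f (x + u) - f (x + v) + f x - (hess x *v v) \<bullet> u\<bar>
     \<le> L / 2 * (norm u ^ 2 * norm v + norm u * norm v ^ 2)"
proof -
  let ?p = "\<lambda>t. f ((x + v) + t *\<^sub>R u) - f (x + t *\<^sub>R u) - t * ((hess x *v v) \<bullet> u)"
  let ?q = "\<lambda>t. L / 2 * (t ^ 2 * norm u ^ 2 * norm v + t * norm u * norm v ^ 2)"
  have "norm (?p 1 - ?p 0) \<le> ?q 1 - ?q 0"
  proof (rule line_bound)
    show "(?p has_vector_derivative
        grad ((x + v) + t *\<^sub>R u) \<bullet> u - grad (x + t *\<^sub>R u) \<bullet> u - (hess x *v v) \<bullet> u) (at t)" for t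
      using has_vector_derivative_f_line[of x u t] has_vector_derivative_f_line[of "x + v" u t]
      unfolding has_real_derivative_iff_has_vector_derivative[symmetric]
      by (auto intro!: derivative_eq_intros)
    show "(?q has_vector_derivative L / 2 * (2 * t * norm u ^ 2 * norm v + norm u * norm v ^ 2)) (at t)" for t
      unfolding has_real_derivative_iff_has_vector_derivative[symmetric]
      by (auto intro!: derivative_eq_intros)
    show "norm (grad ((x + v) + t *\<^sub>R u) \<bullet> u - grad (x + t *\<^sub>R u) \<bullet> u - (hess x *v v) \<bullet> u)
        \<le> L / 2 * (2 * t * norm u ^ 2 * norm v + norm u * norm v ^ 2)" if t: "0 < t" for t
    proof -
      let ?z = "x + t *\<^sub>R u"
      have "grad ((x + v) + t *\<^sub>R u) \<bullet> u - grad ?z \<bullet> u - (hess x *v v) \<bullet> u =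
          ((grad (?z + v) - grad ?z - hess ?z *v v) + (hess ?z - hess x) *v v) \<bullet> u"
        by (simp add: matrix_vector_mult_diff_rdistrib algebra_simps)
      also have "norm \<dots> \<le>
          norm ((grad (?z + v) - grad ?z - hess ?z *v v) + (hess ?z - hess x) *v v) * norm u"
        by (rule Cauchy_Schwarz_ineq2[folded real_norm_def])
      also have "\<dots> \<le> (L / 2 * norm v ^ 2 + L * norm (?z - x) * norm v) * norm u"
        by (intro mult_right_mono norm_triangle_le add_mono grad_taylor hess_lipschitz) simp
      finally show ?thesis
        using t by (simp add: power2_eq_square algebra_simps)
    qed
  qed
  then show ?thesis by (simp add: algebra_simps)
qed

text \<open>In a central difference the Hessian terms of the two expansions cancel, so only the
  cubic remainders \<open>E1\<close> and \<open>E2\<close> survive, divided by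
  \<open>2 * h\<close>.\<close>

lemma fd_grad_error:
  assumes "0 < h"
  shows "norm (fd_grad f h x - grad x) \<le> sqrt (real CARD('n)) * (L / 6 * h ^ 2)"
proof (rule norm_le_sqrt_card)
  fix i :: 'n
  let ?e = "axis i 1 :: real ^ 'n"
  define E1 where "E1 = f (x + h *\<^sub>R ?e) - f x - grad x \<bullet> (h *\<^sub>R ?e)
    - 1 / 2 * ((hess x *v (h *\<^sub>R ?e)) \<bullet> (h *\<^sub>R ?e))"
  define E2 where "E2 = f (x + - (h *\<^sub>R ?e)) - f x - grad x \<bullet> (- (h *\<^sub>R ?e))
    - 1 / 2 * ((hess x *v (- (h *\<^sub>R ?e))) \<bullet> (- (h *\<^sub>R ?e)))"
  have "\<bar>E1\<bar> \<le> L / 6 * h ^ 3" "\<bar>E2\<bar> \<le> L / 6 * h ^ 3"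
    using f_taylor[of x "h *\<^sub>R ?e"] f_taylor[of x "- (h *\<^sub>R ?e)"] \<open>0 < h\<close>
    unfolding E1_def E2_def by (simp_all add: norm_axis_1)
  then have E: "\<bar>(E1 - E2) / (2 * h)\<bar> \<le> (L / 6 * h ^ 3 + L / 6 * h ^ 3) / (2 * h)"
    using \<open>0 < h\<close> unfolding abs_divide by (intro frac_le) (linarith, linarith, simp_all)
  have "(fd_grad f h x - grad x) $ i = (E1 - E2) / (2 * h)"
  proof -
    have "E1 - E2 = f (x + h *\<^sub>R ?e) - f (x - h *\<^sub>R ?e) - 2 * h * grad x $ i"
      unfolding E1_def E2_def using matrix_vector_mult_scaleR[of "hess x" "-1" "h *\<^sub>R ?e"]
      by (simp add: inner_axis algebra_simps)
    then show ?thesis using \<open>0 < h\<close> by (simp add: fd_grad_def field_simps)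
  qed
  with E show "\<bar>(fd_grad f h x - grad x) $ i\<bar> \<le> L / 6 * h ^ 2"
    using \<open>0 < h\<close> by (simp add: power2_eq_square power3_eq_cube)
qed

text \<open>For \<open>u\<close> and \<open>v\<close> of length \<open>h\<close> the second
  difference errs by at most \<open>L * h ^ 3\<close>; division by \<open>h ^ 2\<close> leaves
  \<open>L * h\<close> per entry.\<close>

lemma fd_hess_error:
  assumes "0 < h"
  shows "norm ((hess x - fd_hess f h x) *v v) \<le> real CARD('n) * (L * h) * norm v"
proof (rule norm_matrix_vector_le_entry_bound)
  fix i j :: 'n
  let ?u = "h *\<^sub>R axis i 1 :: real ^ 'n" and ?v = "h *\<^sub>R axis j 1 :: real ^ 'n"
  let ?D = "f (x + ?u + ?v) - f (x + ?u) - f (x + ?v) + f x"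
  have "(hess x *v ?v) \<bullet> ?u = h ^ 2 * hess x $ i $ j"
    by (simp add: matrix_vector_mult_scaleR inner_axis matrix_vector_mul_component power2_eq_square)
  then have "\<bar>?D - h ^ 2 * hess x $ i $ j\<bar> \<le> L * h * h ^ 2"
    using second_difference_bound[of x ?u ?v] \<open>0 < h\<close>
    by (simp add: norm_axis_1 power2_eq_square algebra_simps)
  moreover have "?D - h ^ 2 * hess x $ i $ j = - (h ^ 2) * (hess x - fd_hess f h x) $ i $ j"
    using \<open>0 < h\<close> by (simp add: fd_hess_def field_simps)
  ultimately show "\<bar>(hess x - fd_hess f h x) $ i $ j\<bar> \<le> L * h"
    using \<open>0 < h\<close> by (simp add: abs_mult)
qed

end

text \<open>The formula is symmetric in \<open>i\<close> and \<open>j\<close>. With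
  \<open>sym_part_symmetric\<close>, the matrix of the algorithm equals \<open>fd_hess\<close>, so
  \<open>fd_hess_error\<close> applies to it.\<close>

lemma transpose_fd_hess: "transpose (fd_hess f h x) = fd_hess f h x"
  by (simp add: transpose_def fd_hess_def vec_eq_iff algebra_simps)

lemma sym_part_symmetric: "transpose A = A \<Longrightarrow> sym_part A = A"
  by (simp add: sym_part_def scaleR_2[symmetric])

section \<open>Power sums of the step lengths under a lazy Hessian\<close>

text \<open>Weighted AM-GM summed over all pairs of indices. It turns the drift away from the
  Hessian point into a cubic term with factor \<open>T\<close>.\<close>

lemma sum_mult_sum_square_le_sum_cube:
  fixes r :: "nat \<Rightarrow> real"
  assumes "\<And>t. t < T \<Longrightarrow> 0 \<le> r t"
  shows "(\<Sum>t<T. r t) * (\<Sum>t<T. r t ^ 2) \<le> real T * (\<Sum>t<T. r t ^ 3)"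
proof -
  have *: "a * b ^ 2 \<le> a ^ 3 / 3 + 2 / 3 * b ^ 3" if "0 \<le> a" "0 \<le> b" for a b :: real
  proof -
    \<comment> \<open>The product expands to
      \<open>a ^ 3 - 3 * a * b ^ 2 + 2 * b ^ 3\<close>.\<close>
    have "0 \<le> (a - b) ^ 2 * (a + 2 * b)" using that by simp
    then show ?thesis by (simp add: power2_eq_square power3_eq_cube algebra_simps)
  qed
  have "(\<Sum>t<T. r t) * (\<Sum>t<T. r t ^ 2) = (\<Sum>i<T. \<Sum>t<T. r i * r t ^ 2)"
    by (simp add: sum_product)
  also have "\<dots> \<le> (\<Sum>i<T. \<Sum>t<T. r i ^ 3 / 3 + 2 / 3 * r t ^ 3)"
    by (intro sum_mono *) (use assms in auto)
  also have "\<dots> = real T * (\<Sum>t<T. r t ^ 3)"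
    by (simp add: sum.distrib flip: sum_distrib_left sum_divide_distrib)
  finally show ?thesis .
qed

text \<open>
  Here \<open>r t\<close> is the length of step \<open>t\<close>, so the partial sums of \<open>r\<close> bound the distance to the point
  where the Hessian estimate was computed. The thresholds \<open>s\<close>, \<open>13\<close>, \<open>30\<close>, \<open>100\<close> leave a lot of room.
\<close>

lemma lazy_cubic_decrease:
  fixes r :: "nat \<Rightarrow> real"
  assumes r: "\<And>t. t < T \<Longrightarrow> 0 \<le> r t"
    and T: "T \<le> m" and L: "0 \<le> L" "13 * L * real m \<le> \<sigma>" and m: "0 < m"
    and s: "0 \<le> s"
    and grad_large: "\<And>t. t < T \<Longrightarrow> \<sigma> * s ^ 2 \<le>
        3 / 4 * \<sigma> * r t ^ 2 + L / 2 * r t ^ 2 + L * (\<Sum>i<t. r i) * r t + \<sigma> * s / 30 * r t + \<sigma> * s ^ 2 / 100"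
  shows "\<sigma> * s ^ 3 / 384 * real T \<le>
    (\<Sum>t<T. \<sigma> / 6 * r t ^ 3 - L / 6 * r t ^ 3 - \<sigma> * s ^ 2 / 100 * r t
        - 1 / 2 * (L * (\<Sum>i<t. r i) + \<sigma> * s / 30) * r t ^ 2)"
proof -
  define S where "S p = (\<Sum>t<T. r t ^ p)" for p :: nat
  have S_nonneg: "0 \<le> S p" for p unfolding S_def using r by (intro sum_nonneg) auto
  have S0: "S 0 = real T" by (simp add: S_def)
  have "L \<le> L * real m" using m L by (simp add: mult_le_cancel_left1)
  then have sig: "0 \<le> \<sigma>" "L \<le> \<sigma> / 13" using L by linarith+
  have part: "(\<Sum>i<t. r i) \<le> S 1" if "t < T" for t
    unfolding S_def using that r by (auto intro!: sum_mono2)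
  have LT: "L * real T \<le> \<sigma> / 13"
    using mult_left_mono[of "real T" "real m" L] T L by simp
  \<comment> \<open>Partial sums are replaced by the total, then Cauchy-Schwarz applies;
    \<open>T \<le> m\<close> makes \<open>L * real T\<close> a small fraction of
    \<open>\<sigma>\<close>.\<close>
  have "(\<Sum>t<T. (\<Sum>i<t. r i) * r t) \<le> (\<Sum>t<T. S 1 * r t)"
    by (intro sum_mono mult_right_mono part r) auto
  also have "\<dots> = (S 1)\<^sup>2" by (simp add: S_def sum_distrib_left power2_eq_square)
  also have "\<dots> \<le> real T * S 2"
    using sum_squared_le_sum_of_squares[of r "{..<T}"] by (simp add: S_def mult.commute)
  finally have "L * (\<Sum>t<T. (\<Sum>i<t. r i) * r t) \<le> L * real T * S 2"
    using L by (simp add: mult_left_mono mult.assoc)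
  also have "\<dots> \<le> \<sigma> / 13 * S 2" by (intro mult_right_mono LT S_nonneg)
  finally have R1: "L * (\<Sum>t<T. (\<Sum>i<t. r i) * r t) \<le> \<sigma> / 13 * S 2" .
  have "(\<Sum>t<T. (\<Sum>i<t. r i) * r t ^ 2) \<le> (\<Sum>t<T. S 1 * r t ^ 2)"
    by (intro sum_mono mult_right_mono part) auto
  also have "\<dots> = S 1 * S 2" by (simp add: S_def sum_distrib_left)
  also have "\<dots> \<le> real T * S 3"
    using sum_mult_sum_square_le_sum_cube[of T r] r by (simp add: S_def)
  finally have "L * (\<Sum>t<T. (\<Sum>i<t. r i) * r t ^ 2) \<le> L * real T * S 3"
    using L by (simp add: mult_left_mono mult.assoc)
  also have "\<dots> \<le> \<sigma> / 13 * S 3" by (intro mult_right_mono LT S_nonneg)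
  finally have R2: "L * (\<Sum>t<T. (\<Sum>i<t. r i) * r t ^ 2) \<le> \<sigma> / 13 * S 3" .
  \<comment> \<open>Summing \<open>grad_large\<close> gives a lower bound on \<open>S 2\<close>,
    once \<open>S1\<close> has removed the linear term.\<close>
  have "(\<Sum>t<T. \<sigma> * s ^ 2) \<le> (\<Sum>t<T. 3 / 4 * \<sigma> * r t ^ 2 + L / 2 * r t ^ 2
      + L * ((\<Sum>i<t. r i) * r t) + \<sigma> * s / 30 * r t + \<sigma> * s ^ 2 / 100)"
    using grad_large by (intro sum_mono) (auto simp: mult.assoc)
  also have "\<dots> = 3 / 4 * \<sigma> * S 2 + L / 2 * S 2 + L * (\<Sum>t<T. (\<Sum>i<t. r i) * r t)
      + \<sigma> * s / 30 * S 1 + real T * (\<sigma> * s ^ 2 / 100)"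
    by (simp only: sum.distrib S_def power_one_right sum_distrib_left sum_constant card_lessThan)
  finally have "real T * (\<sigma> * s ^ 2) \<le> 3 / 4 * \<sigma> * S 2 + \<sigma> / 26 * S 2 + \<sigma> / 13 * S 2
      + \<sigma> * s / 30 * S 1 + real T * (\<sigma> * s ^ 2 / 100)"
    using R1 mult_right_mono[OF sig(2) S_nonneg[of 2]] by simp
  moreover have S1: "2 * s * S 1 \<le> s\<^sup>2 * real T + S 2"
  proof -
    have "0 \<le> (\<Sum>t<T. (r t - s)\<^sup>2)" by (intro sum_nonneg) auto
    also have "\<dots> = (\<Sum>t<T. r t ^ 2 - 2 * s * r t ^ 1 + s\<^sup>2 * r t ^ 0)"
      by (intro sum.cong) (auto simp: power2_eq_square algebra_simps)
    also have "\<dots> = S 2 - 2 * s * S 1 + s\<^sup>2 * S 0"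
      by (simp only: sum.distrib sum_subtractf S_def sum_distrib_left)
    finally show ?thesis by (simp add: S0)
  qed
  moreover have "\<sigma> * (2 * s * S 1) \<le> \<sigma> * (s\<^sup>2 * real T + S 2)"
    using S1 sig by (intro mult_left_mono)
  \<comment> \<open>After inserting \<open>S1\<close>, the coefficient of \<open>S 2\<close> is 3/4
    + 1/26 + 1/13 + 1/60 < 9/10, while the left side keeps 1 - 1/100 - 1/60 > 9/10.\<close>
  ultimately have "\<sigma> * (s\<^sup>2 * real T) \<le> \<sigma> * S 2"
    using mult_nonneg_nonneg[OF sig(1) S_nonneg[of 2]] by (simp add: algebra_simps)
  then have S2: "\<sigma> * s * (s\<^sup>2 * real T) \<le> \<sigma> * s * S 2"
    using mult_left_mono[OF _ s, of "\<sigma> * (s\<^sup>2 * real T)" "\<sigma> * S 2"] by (simp add: algebra_simps)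
  have S3: "3 * s * S 2 \<le> 2 * S 3 + s ^ 3 * real T"
  proof -
    \<comment> \<open>The summand expands to \<open>2 * r t ^ 3 - 3 * s * r t ^ 2 + s ^ 3\<close>,
      an AM-GM gap that vanishes at \<open>r t = s\<close>.\<close>
    have "0 \<le> (\<Sum>t<T. (r t - s)\<^sup>2 * (2 * r t + s))"
      using r s by (intro sum_nonneg) auto
    also have "\<dots> = (\<Sum>t<T. 2 * r t ^ 3 - 3 * s * r t ^ 2 + s ^ 3 * r t ^ 0)"
      by (intro sum.cong) (auto simp: power2_eq_square power3_eq_cube algebra_simps)
    also have "\<dots> = 2 * S 3 - 3 * s * S 2 + s ^ 3 * S 0"
      by (simp only: sum.distrib sum_subtractf S_def sum_distrib_left)
    finally show ?thesis by (simp add: S0)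
  qed
  have a: "\<sigma> * (3 * s * S 2) \<le> \<sigma> * (2 * S 3 + s ^ 3 * real T)"
    using S3 sig by (intro mult_left_mono)
  have b: "\<sigma> * s * (2 * s * S 1) \<le> \<sigma> * s * (s\<^sup>2 * real T + S 2)"
    using S1 sig s by (intro mult_left_mono) auto
  have c: "L * S 3 \<le> \<sigma> / 13 * S 3" by (intro mult_right_mono sig S_nonneg)
  have "(\<Sum>t<T. \<sigma> / 6 * r t ^ 3 - L / 6 * r t ^ 3 - \<sigma> * s ^ 2 / 100 * r t
        - 1 / 2 * (L * (\<Sum>i<t. r i) + \<sigma> * s / 30) * r t ^ 2) =
      (\<Sum>t<T. \<sigma> / 6 * r t ^ 3 - L / 6 * r t ^ 3 - \<sigma> * s ^ 2 / 100 * r t ^ 1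
        - 1 / 2 * (L * ((\<Sum>i<t. r i) * r t ^ 2)) - \<sigma> * s / 60 * r t ^ 2)"
    by (intro sum.cong) (auto simp: algebra_simps)
  also have "\<dots> = \<sigma> / 6 * S 3 - L / 6 * S 3 - \<sigma> * s ^ 2 / 100 * S 1
      - 1 / 2 * (L * (\<Sum>t<T. (\<Sum>i<t. r i) * r t ^ 2)) - \<sigma> * s / 60 * S 2"
    by (simp only: sum_subtractf S_def sum_distrib_left)
  finally have eq: "(\<Sum>t<T. \<sigma> / 6 * r t ^ 3 - L / 6 * r t ^ 3 - \<sigma> * s ^ 2 / 100 * r t
        - 1 / 2 * (L * (\<Sum>i<t. r i) + \<sigma> * s / 30) * r t ^ 2) = \<dots>" .
  define P Q R U where "P = \<sigma> * S 3" and "Q = \<sigma> * s * S 2" and "R = \<sigma> * s\<^sup>2 * S 1" and "U = \<sigma> * s ^ 3 * real T"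
  have "0 \<le> U" using sig s by (simp add: U_def)
  have "U \<le> Q" "3 * Q \<le> 2 * P + U" "2 * R \<le> U + Q" "L * S 3 \<le> P / 13"
      "L * (\<Sum>t<T. (\<Sum>i<t. r i) * r t ^ 2) \<le> P / 13"
    using S2 a b c R2 unfolding P_def Q_def R_def U_def
    by (simp_all add: power2_eq_square power3_eq_cube algebra_simps)
  \<comment> \<open>The listed facts imply \<open>U \<le> Q\<close>, \<open>Q \<le> P\<close> and
    \<open>R \<le> Q\<close>. The net coefficient of \<open>P\<close> is 1/6 - 1/78 - 1/26 = 3/26,
    well above 1/100 + 1/60 + 1/384.\<close>
  then have "U / 384 \<le> P / 6 - (L * S 3) / 6 - R / 100
      - 1 / 2 * (L * (\<Sum>t<T. (\<Sum>i<t. r i) * r t ^ 2)) - Q / 60"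
    using \<open>0 \<le> U\<close> by linarith
  then show ?thesis
    unfolding eq by (simp add: P_def Q_def R_def U_def algebra_simps)
qed

section \<open>Numerical bounds on the parameters of the algorithm\<close>

lemma cube_powr_third:
  assumes "0 \<le> (a::real)"
  shows "(a powr (1 / 3)) ^ 3 = a"
  using powr_power[where z = a and n = 3 and u = "1 / 3"] assms by (cases "a = 0") simp_all

lemma powr_three_halves:
  assumes "0 \<le> (a::real)"
  shows "a powr (3 / 2) = sqrt a ^ 3"
  using powr_power[where z = a and n = 3 and u = "1 / 2"] assms
  by (cases "a = 0") (simp_all add: powr_half_sqrt)

lemma le_if_cube_le: "a ^ 3 \<le> b ^ 3 \<Longrightarrow> 0 \<le> b \<Longrightarrow> a \<le> b" for a b :: real
  using power_le_imp_le_base[of a 2 b] by (simp add: numeral_3_eq_3)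

text \<open>16 times the cube root of 2/3 is about 13.98; the enclosure is checked by comparing
  cubes.\<close>

lemma reg_param_bounds:
  assumes "0 \<le> M"
  shows "13 * M * real m \<le> reg_param m M" "reg_param m M \<le> 14 * M * real m"
proof -
  have "((2 / 3 :: real) powr (1 / 3)) ^ 3 = 2 / 3" by (rule cube_powr_third) simp
  then have "((13 / 16) ^ 3 :: real) \<le> ((2 / 3) powr (1 / 3)) ^ 3" "((2 / 3) powr (1 / 3)) ^ 3 \<le> ((14 / 16) ^ 3 :: real)"
    by (simp_all only:) (simp_all add: power3_eq_cube)
  then have a: "13 / 16 \<le> (2 / 3 :: real) powr (1 / 3)" "(2 / 3 :: real) powr (1 / 3) \<le> 14 / 16"
    by (auto elim!: le_if_cube_le)
  have "0 \<le> M * real m" using assms by simp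
  from mult_right_mono[OF a(1) this] mult_right_mono[OF a(2) this]
  show "13 * M * real m \<le> reg_param m M" "reg_param m M \<le> 14 * M * real m"
    unfolding reg_param_def by (simp_all add: algebra_simps)
qed

lemma grad_step_size_pos:
  assumes "0 < n" "0 < m" "0 < \<sigma>" "0 < \<epsilon>"
  shows "0 < grad_step_size n \<sigma> m \<epsilon>"
  using assms by (simp add: grad_step_size_def)

text \<open>Uses \<open>3 powr (2 / 3) \<ge> 2\<close>, checked through 1.42, whose cube is below 3
  and whose square is above 2.\<close>

lemma grad_step_size_square_le:
  assumes "0 < n" "0 < \<sigma>" "0 < \<epsilon>"
  shows "(grad_step_size n \<sigma> m \<epsilon>)\<^sup>2 \<le> \<epsilon> * real m / (2 * \<sigma> * sqrt (real n))"
proof -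
  let ?b = "(3::real) powr (1 / 3)"
  have "?b ^ 3 = 3" by (rule cube_powr_third) simp
  then have "(142 / 100) ^ 3 \<le> ?b ^ 3" by (simp only:) (simp add: power3_eq_cube)
  then have "142 / 100 \<le> ?b" by (rule le_if_cube_le) simp
  then have "(142 / 100) ^ 2 \<le> ?b ^ 2" by (intro power_mono) auto
  then have b: "2 \<le> ?b ^ 2" by (simp add: power2_eq_square)
  have "(grad_step_size n \<sigma> m \<epsilon>)\<^sup>2 = \<epsilon> * real m / (\<sigma> * sqrt (real n)) / ?b ^ 2"
    using assms by (simp add: grad_step_size_def power_divide power_mult_distrib)
  also have "\<dots> \<le> \<epsilon> * real m / (\<sigma> * sqrt (real n)) / 2"
    using assms b by (intro divide_left_mono) auto
  finally show ?thesis by (simp add: ac_simps)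
qed

lemma hess_step_size_pos:
  assumes "0 < n" "0 < \<sigma>" "0 < \<epsilon>" "0 < M"
  shows "0 < hess_step_size n \<sigma> \<epsilon> M"
  using assms by (simp add: hess_step_size_def)

text \<open>In the cube the powers of \<open>n\<close> and \<open>M\<close> cancel, leaving 81 /
  3145728 with \<open>3145728 = 2 ^ 14 * 192\<close>, which is below
  \<open>1 / 30 ^ 3\<close>.\<close>

lemma hess_step_size_le:
  assumes "0 < n" "0 < \<sigma>" "0 < \<epsilon>" "0 < M"
  shows "real n * M * hess_step_size n \<sigma> \<epsilon> M \<le> sqrt (\<sigma> * \<epsilon>) / 30"
proof (rule le_if_cube_le)
  let ?X = "3 ^ 4 * \<sigma> powr (3 / 2) * \<epsilon> powr (3 / 2) / (2 ^ 14 * 192 * real n ^ 3 * M ^ 3)"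
  have "hess_step_size n \<sigma> \<epsilon> M ^ 3 = ?X"
    unfolding hess_step_size_def by (rule cube_powr_third) (use assms in auto)
  then have "(real n * M * hess_step_size n \<sigma> \<epsilon> M) ^ 3 = (real n * M) ^ 3 * ?X"
    by (simp add: power_mult_distrib)
  also have "\<dots> = 81 / 3145728 * sqrt (\<sigma> * \<epsilon>) ^ 3"
    using assms by (simp add: powr_three_halves real_sqrt_mult power_mult_distrib)
  also have "\<dots> \<le> 1 / 27000 * sqrt (\<sigma> * \<epsilon>) ^ 3"
    using assms by (intro mult_right_mono) auto
  also have "\<dots> = (sqrt (\<sigma> * \<epsilon>) / 30) ^ 3" by (simp add: power_divide)
  finally show "(real n * M * hess_step_size n \<sigma> \<epsilon> M) ^ 3 \<le> (sqrt (\<sigma> * \<epsilon>) / 30) ^ 3" .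
qed (use assms in simp)

section \<open>Descent within one call while no iterate is near stationary\<close>

lemma objective_eq_ereal:
  assumes "x \<in> edom \<psi>" "\<psi> x \<noteq> -\<infinity>"
  shows "objective f \<psi> x = ereal (f x + real_of_ereal (\<psi> x))"
  using assms by (cases "\<psi> x") (auto simp: objective_def edom_def)

text \<open>The step does not increase the model objective above \<open>F x\<close>; the last
  summand is the price of replacing the model by \<open>f\<close>.\<close>

lemma cubic_step_objective_le:
  assumes step: "cubic_step f \<psi> B \<sigma> m \<epsilon> (x :: real ^ 'n) y"
    and fin: "\<And>x. \<psi> x \<noteq> -\<infinity>" and x: "x \<in> edom \<psi>"
  shows "f y + real_of_ereal (\<psi> y) \<le> f x + real_of_ereal (\<psi> x) +
    (f y - cubic_model f (fd_grad f (grad_step_size CARD('n) \<sigma> m \<epsilon>) x) B \<sigma> x y)"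
proof -
  let ?M = "cubic_model f (fd_grad f (grad_step_size CARD('n) \<sigma> m \<epsilon>) x) B \<sigma> x y"
  have y: "y \<in> edom \<psi>" and le: "ereal ?M + \<psi> y \<le> objective f \<psi> x"
    using step by (auto simp: cubic_step_def Let_def)
  obtain p where "\<psi> y = ereal p"
    using y fin[of y] by (cases "\<psi> y") (auto simp: edom_def)
  with le show ?thesis
    by (simp add: objective_eq_ereal[OF x fin])
qed

context lipschitz_hessian
begin

text \<open>\<open>z\<close> is the point of the Hessian estimate. The residual splits into model
  residual, cubic term, Taylor remainder, Hessian drift and finite-difference errors; 3/4 is 1/4
  from inexact stationarity plus 1/2 from the cubic term.\<close>

lemma model_step_gradient_le:
  assumes B: "transpose B = B" "\<And>v. norm ((hess z - B) *v v) \<le> \<delta>B * norm v"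
    and g: "norm (g - grad x) \<le> \<delta>g"
    and gM: "GDERIV (cubic_model f g B \<sigma> x) y :> gM"
    and stat: "norm (gM + s) \<le> \<sigma> / 4 * norm (y - x) ^ 2" and "0 \<le> \<sigma>"
  shows "norm (grad y + s) \<le> 3 / 4 * \<sigma> * norm (y - x) ^ 2 + L / 2 * norm (y - x) ^ 2
    + L * norm (x - z) * norm (y - x) + \<delta>B * norm (y - x) + \<delta>g"
proof -
  define d where "d = y - x"
  have "gM = g + B *v d + (\<sigma> / 2 * norm d) *\<^sub>R d"
    using GDERIV_unique[OF gM GDERIV_cubic_model[OF B(1)]] by (simp add: d_def)
  then have "grad y + s = (gM + s) - (\<sigma> / 2 * norm d) *\<^sub>R d + (grad (x + d) - grad x - hess x *v d)
      + (hess x - hess z) *v d + (hess z - B) *v d - (g - grad x)"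
    by (simp add: d_def matrix_vector_mult_diff_rdistrib)
  also have "norm \<dots> \<le> norm (gM + s) + norm ((\<sigma> / 2 * norm d) *\<^sub>R d)
      + norm (grad (x + d) - grad x - hess x *v d)
      + norm ((hess x - hess z) *v d) + norm ((hess z - B) *v d) + norm (g - grad x)"
    by (intro norm_triangle_le norm_triangle_le_diff add_mono order_refl)
  also have "\<dots> \<le> \<sigma> / 4 * norm d ^ 2 + \<sigma> / 2 * norm d ^ 2 + L / 2 * norm d ^ 2
      + L * norm (x - z) * norm d + \<delta>B * norm d + \<delta>g"
    using stat \<open>0 \<le> \<sigma>\<close> unfolding d_def[symmetric]
    by (intro add_mono grad_taylor hess_lipschitz B g) (simp_all add: power2_eq_square)
  finally show ?thesis unfolding d_def by (simp add: algebra_simps)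
qed

text \<open>The analogous splitting for function values; the negative cubic term is what pays for
  the errors.\<close>

lemma f_le_cubic_model:
  assumes B: "\<And>v. norm ((hess z - B) *v v) \<le> \<delta>B * norm v"
    and g: "norm (g - grad x) \<le> \<delta>g"
  shows "f y - cubic_model f g B \<sigma> x y \<le> L / 6 * norm (y - x) ^ 3 - \<sigma> / 6 * norm (y - x) ^ 3
    + \<delta>g * norm (y - x) + 1 / 2 * (L * norm (x - z) + \<delta>B) * norm (y - x) ^ 2"
proof -
  define d where "d = y - x"
  define T where "T = f (x + d) - f x - grad x \<bullet> d - 1 / 2 * ((hess x *v d) \<bullet> d)"
  have cs: "u \<bullet> d \<le> b * norm d" if "norm u \<le> b" for u b
    using norm_cauchy_schwarz[of u d] mult_right_mono[OF that norm_ge_zero[of d]] by linarith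
  have eq: "f y - cubic_model f g B \<sigma> x y = T - (g - grad x) \<bullet> d
      + 1 / 2 * (((hess x - hess z) *v d) \<bullet> d + ((hess z - B) *v d) \<bullet> d) - \<sigma> / 6 * norm d ^ 3"
    unfolding cubic_model_def T_def d_def
    by (simp add: matrix_vector_mult_diff_rdistrib inner_diff_left algebra_simps)
  have "T \<le> L / 6 * norm d ^ 3" using f_taylor[of x d] unfolding T_def by linarith
  moreover have "- ((g - grad x) \<bullet> d) \<le> \<delta>g * norm d"
    using cs[of "- (g - grad x)"] g by (simp only: norm_minus_cancel inner_minus_left)
  moreover have "((hess x - hess z) *v d) \<bullet> d \<le> L * norm (x - z) * norm d * norm d"
    by (intro cs hess_lipschitz)
  moreover have "((hess z - B) *v d) \<bullet> d \<le> \<delta>B * norm d * norm d"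
    by (intro cs B)
  ultimately show ?thesis
    unfolding eq d_def[symmetric] by (simp add: power2_eq_square algebra_simps)
qed

text \<open>Stated for every prefix length \<open>T\<close>, because the procedure tests the
  decrease after each inner step.\<close>

lemma cubic_steps_decrease:
  fixes \<psi> :: "real ^ 'n \<Rightarrow> ereal" and y :: "nat \<Rightarrow> real ^ 'n" and \<epsilon> M :: real
  defines "\<sigma> \<equiv> reg_param CARD('n) M"
  defines "B \<equiv> sym_part (fd_hess f (hess_step_size CARD('n) \<sigma> \<epsilon> M) (y 0))"
  assumes fin: "\<And>x. \<psi> x \<noteq> -\<infinity>" and y0: "y 0 \<in> edom \<psi>"
    and eps: "0 < \<epsilon>" and M: "0 < M" "L \<le> M"
    and steps: "\<And>t. t < T \<Longrightarrow> cubic_step f \<psi> B \<sigma> CARD('n) \<epsilon> (y t) (y (Suc t))"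
    and T: "T \<le> CARD('n)"
    and large: "\<And>t s. t < T \<Longrightarrow> s \<in> subdiff \<psi> (y (Suc t)) \<Longrightarrow> \<epsilon> < norm (grad (y (Suc t)) + s)"
  shows "objective f \<psi> (y 0) - objective f \<psi> (y T) \<ge> ereal (\<epsilon> powr (3 / 2) / (384 * sqrt \<sigma>) * real T)"
proof -
  let ?n = "real CARD('n)"
  let ?F = "\<lambda>x. f x + real_of_ereal (\<psi> x)"
  have "0 < M * ?n" using M by simp
  with reg_param_bounds[of M "CARD('n)"] M
  have \<sigma>: "0 < \<sigma>" "13 * M * ?n \<le> \<sigma>" unfolding \<sigma>_def by (simp_all, linarith)
  have "L * ?n \<le> M * ?n" using M by (intro mult_right_mono) auto
  with \<sigma> have L\<sigma>: "13 * L * ?n \<le> \<sigma>" unfolding mult.assoc by linarith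
  \<comment> \<open>The length scale with \<open>\<sigma> * s ^ 2 = \<epsilon>\<close>;
    \<open>\<sigma> * s\<close> then scales the Hessian error and \<open>\<sigma> * s ^ 3\<close>
    the decrease.\<close>
  define s where "s = sqrt (\<epsilon> / \<sigma>)"
  have s0: "0 \<le> s" using \<sigma> eps by (simp add: s_def)
  have s2: "\<sigma> * s ^ 2 = \<epsilon>" using \<sigma> eps by (simp add: s_def)
  have s1: "sqrt (\<sigma> * \<epsilon>) = \<sigma> * s"
    using \<sigma> eps by (simp add: s_def real_sqrt_mult real_sqrt_divide field_simps)
  have s3: "\<epsilon> powr (3 / 2) / (384 * sqrt \<sigma>) = \<sigma> * s ^ 3 / 384"
  proof -
    have "\<sigma> * s ^ 3 = sqrt \<sigma> ^ 2 * (sqrt \<epsilon> / sqrt \<sigma>) ^ 3"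
      using \<sigma> by (simp add: s_def real_sqrt_divide)
    also have "\<dots> = sqrt \<epsilon> ^ 3 / sqrt \<sigma>"
      using \<sigma> by (simp add: power_divide power2_eq_square power3_eq_cube field_simps)
    finally show ?thesis using eps by (simp add: powr_three_halves field_simps)
  qed
  have hpos: "0 < hess_step_size CARD('n) \<sigma> \<epsilon> M" and gpos: "0 < grad_step_size CARD('n) \<sigma> CARD('n) \<epsilon>"
    using \<sigma> eps M by (auto intro!: hess_step_size_pos grad_step_size_pos)
  have Beq: "B = fd_hess f (hess_step_size CARD('n) \<sigma> \<epsilon> M) (y 0)"
    unfolding B_def by (intro sym_part_symmetric transpose_fd_hess)
  have Bt: "transpose B = B" unfolding Beq by (rule transpose_fd_hess)
  have Berr: "norm ((hess (y 0) - B) *v v) \<le> \<sigma> * s / 30 * norm v" for v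
  proof -
    have "norm ((hess (y 0) - B) *v v) \<le> ?n * (L * hess_step_size CARD('n) \<sigma> \<epsilon> M) * norm v"
      unfolding Beq by (rule fd_hess_error[OF hpos])
    also have "\<dots> \<le> ?n * M * hess_step_size CARD('n) \<sigma> \<epsilon> M * norm v"
      using hpos M by (intro mult_right_mono) (auto simp: mult.assoc intro!: mult_left_mono mult_right_mono)
    also have "\<dots> \<le> \<sigma> * s / 30 * norm v"
      using hess_step_size_le[of "CARD('n)" \<sigma> \<epsilon> M] \<sigma> eps M s1 by (intro mult_right_mono) auto
    finally show ?thesis .
  qed
  have gerr: "norm (fd_grad f (grad_step_size CARD('n) \<sigma> CARD('n) \<epsilon>) x - grad x) \<le> \<sigma> * s ^ 2 / 100" for x
  proof -
    have "norm (fd_grad f (grad_step_size CARD('n) \<sigma> CARD('n) \<epsilon>) x - grad x)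
        \<le> sqrt ?n * (L / 6 * (grad_step_size CARD('n) \<sigma> CARD('n) \<epsilon>)\<^sup>2)"
      by (rule fd_grad_error[OF gpos])
    also have "\<dots> \<le> sqrt ?n * (L / 6 * (\<epsilon> * ?n / (2 * \<sigma> * sqrt ?n)))"
      using L_nonneg \<sigma> eps by (intro mult_left_mono grad_step_size_square_le) auto
    \<comment> \<open>The square roots of the dimension cancel. The remaining ratio is at most 1/13,
      and 12 * 13 exceeds 100.\<close>
    also have "\<dots> = \<epsilon> * (L * ?n / \<sigma>) / 12" by (simp add: mult_ac)
    also have "\<dots> \<le> \<epsilon> * (1 / 13) / 12"
      using L\<sigma> \<sigma> eps by (intro divide_right_mono mult_left_mono) (auto simp: field_simps)
    also have "\<dots> \<le> \<epsilon> / 100" using eps by simp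
    finally show ?thesis using s2 by simp
  qed
  define r where "r t = norm (y (Suc t) - y t)" for t
  \<comment> \<open>The path length bounds the distance to the point where the Hessian was
    estimated.\<close>
  have dist: "norm (y t - y 0) \<le> (\<Sum>i<t. r i)" for t
    unfolding r_def by (subst sum_lessThan_telescope[symmetric]) (rule norm_sum)
  have Ldist: "L * norm (y t - y 0) \<le> L * (\<Sum>i<t. r i)" for t
    by (intro mult_left_mono dist L_nonneg)
  have dom: "y t \<in> edom \<psi>" if "t \<le> T" for t
    using that y0 steps by (cases t) (auto simp: cubic_step_def Let_def)
  have "\<sigma> * s ^ 3 / 384 * real T \<le>
    (\<Sum>t<T. \<sigma> / 6 * r t ^ 3 - L / 6 * r t ^ 3 - \<sigma> * s ^ 2 / 100 * r t
        - 1 / 2 * (L * (\<Sum>i<t. r i) + \<sigma> * s / 30) * r t ^ 2)"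
  proof (rule lazy_cubic_decrease)
    fix t assume t: "t < T"
    obtain gM s' where gM: "GDERIV (cubic_model f (fd_grad f (grad_step_size CARD('n) \<sigma> CARD('n) \<epsilon>) (y t)) B \<sigma> (y t)) (y (Suc t)) :> gM"
        and s': "s' \<in> subdiff \<psi> (y (Suc t))" "norm (gM + s') \<le> \<sigma> / 4 * norm (y (Suc t) - y t) ^ 2"
      using steps[OF t] by (auto simp: cubic_step_def Let_def)
    have "\<epsilon> < norm (grad (y (Suc t)) + s')" by (rule large[OF t s'(1)])
    also have "\<dots> \<le> 3 / 4 * \<sigma> * r t ^ 2 + L / 2 * r t ^ 2
        + L * norm (y t - y 0) * r t + \<sigma> * s / 30 * r t + \<sigma> * s ^ 2 / 100"
      unfolding r_def using model_step_gradient_le[OF Bt Berr gerr gM s'(2)] \<sigma> by simp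
    also have "\<dots> \<le> 3 / 4 * \<sigma> * r t ^ 2 + L / 2 * r t ^ 2
        + L * (\<Sum>i<t. r i) * r t + \<sigma> * s / 30 * r t + \<sigma> * s ^ 2 / 100"
      by (intro add_mono order_refl mult_right_mono Ldist) (simp add: r_def)
    finally show "\<sigma> * s ^ 2 \<le> \<dots>" unfolding s2 by simp
  qed (use T L_nonneg L\<sigma> s0 in \<open>auto simp: r_def\<close>)
  \<comment> \<open>Each summand bounds the decrease of the objective in one step from below, and
    the decreases telescope.\<close>
  also have "\<dots> \<le> (\<Sum>t<T. ?F (y t) - ?F (y (Suc t)))"
  proof (rule sum_mono)
    fix t assume "t \<in> {..<T}"
    then have t: "t < T" by simp
    have "?F (y (Suc t)) \<le> ?F (y t) + (L / 6 * r t ^ 3 - \<sigma> / 6 * r t ^ 3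
        + \<sigma> * s ^ 2 / 100 * r t + 1 / 2 * (L * norm (y t - y 0) + \<sigma> * s / 30) * r t ^ 2)"
      using cubic_step_objective_le[OF steps[OF t] fin dom] t
        f_le_cubic_model[OF Berr gerr, where x = "y t" and y = "y (Suc t)" and \<sigma> = \<sigma>]
      unfolding r_def by fastforce
    moreover have "(L * norm (y t - y 0) + \<sigma> * s / 30) * r t ^ 2 \<le> (L * (\<Sum>i<t. r i) + \<sigma> * s / 30) * r t ^ 2"
      by (intro mult_right_mono add_mono Ldist) auto
    ultimately show "\<sigma> / 6 * r t ^ 3 - L / 6 * r t ^ 3 - \<sigma> * s ^ 2 / 100 * r t
        - 1 / 2 * (L * (\<Sum>i<t. r i) + \<sigma> * s / 30) * r t ^ 2 \<le> ?F (y t) - ?F (y (Suc t))"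
      by simp
  qed
  also have "\<dots> = ?F (y 0) - ?F (y T)" by (rule sum_lessThan_telescope')
  finally show ?thesis
    unfolding s3 by (simp add: objective_eq_ereal[OF dom fin])
qed

end

section \<open>Successes and halts along a run\<close>

definition near_stationary ::
    "(real ^ 'n \<Rightarrow> real ^ 'n) \<Rightarrow> (real ^ 'n \<Rightarrow> ereal) \<Rightarrow> real \<Rightarrow> real ^ 'n \<Rightarrow> bool" where
  "near_stationary grad \<psi> \<epsilon> x \<longleftrightarrow> (\<exists>s\<in>subdiff \<psi> x. norm (grad x + s) \<le> \<epsilon>)"

context lipschitz_hessian
begin

text \<open>A halt is a failed test at the last inner step, which contradicts
  \<open>cubic_steps_decrease\<close> for the prefix ending there.\<close>

lemma valid_call_succeeds:
  fixes \<psi> :: "real ^ 'n \<Rightarrow> ereal"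
  assumes valid: "valid_call f \<psi> CARD('n) \<epsilon> c"
    and fin: "\<And>x. \<psi> x \<noteq> -\<infinity>" and x: "call_x c \<in> edom \<psi>" and eps: "0 < \<epsilon>"
    and M: "0 < call_M c" "L \<le> call_M c"
    and large: "\<And>t. 1 \<le> t \<Longrightarrow> t \<le> call_steps c \<Longrightarrow> \<not> near_stationary grad \<psi> \<epsilon> (call_iter c t)"
  shows "call_result c = Success"
proof (rule ccontr)
  assume "call_result c \<noteq> Success"
  then have halt: "call_result c = Halt" by (cases "call_result c") auto
  let ?y = "call_iter c"
  have y0: "?y 0 = call_x c"
    and steps: "\<And>t. t < call_steps c \<Longrightarrow>
      cubic_step f \<psi> (sym_part (fd_hess f (hess_step_size CARD('n) (reg_param CARD('n) (call_M c)) \<epsilon> (call_M c)) (?y 0)))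
        (reg_param CARD('n) (call_M c)) CARD('n) \<epsilon> (?y t) (?y (Suc t))"
    using valid by (auto simp: valid_call_def cubic_steps_def call_h_def call_sigma_def)
  obtain T where T: "call_steps c = Suc T" "Suc T \<le> CARD('n)"
      and insuff: "\<not> sufficient_decrease f \<psi> (call_sigma CARD('n) c) \<epsilon> (call_x c) T (?y (Suc T))"
    using valid halt by (auto simp: valid_call_def cubic_steps_def)
  have "objective f \<psi> (?y 0) - objective f \<psi> (?y (Suc T))
      \<ge> ereal (\<epsilon> powr (3 / 2) / (384 * sqrt (reg_param CARD('n) (call_M c))) * real (Suc T))"
  proof (rule cubic_steps_decrease[OF fin])
    show "?y 0 \<in> edom \<psi>" using x y0 by simp
    show "\<epsilon> < norm (grad (?y (Suc t)) + s)" if "t < Suc T" "s \<in> subdiff \<psi> (?y (Suc t))" for t s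
      using large[of "Suc t"] that T by (force simp: near_stationary_def)
  qed (use eps M T steps in auto)
  with insuff show False by (simp add: sufficient_decrease_def call_sigma_def y0)
qed

text \<open>
  \<open>K\<close> is the number of successes among the first \<open>j\<close> calls: a halt doubles \<open>call_M\<close> and a success at
  most halves it, hence \<open>2 ^ (j - K) \<tau>0 \<le> 2 ^ K call_M\<close>.
\<close>

lemma cnm_run_invariant:
  fixes \<psi> :: "real ^ 'n \<Rightarrow> ereal" and F :: "real ^ 'n \<Rightarrow> real"
  defines "F \<equiv> \<lambda>x. f x + real_of_ereal (\<psi> x)"
  assumes run: "cnm_run f \<psi> x0 \<tau>0 CARD('n) \<epsilon> c"
    and fin: "\<And>x. \<psi> x \<noteq> -\<infinity>" and x0: "x0 \<in> edom \<psi>" and tau0: "0 < \<tau>0" and eps: "0 < \<epsilon>"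
    and \<Lambda>: "\<tau>0 \<le> \<Lambda>" "L \<le> \<Lambda>"
    and large: "\<And>i t. i < j \<Longrightarrow> 1 \<le> t \<Longrightarrow> t \<le> call_steps (c i) \<Longrightarrow>
      \<not> near_stationary grad \<psi> \<epsilon> (call_iter (c i) t)"
  shows "\<exists>K. call_x (c j) \<in> edom \<psi> \<and> \<tau>0 \<le> call_tau (c j) \<and> call_tau (c j) \<le> \<Lambda> \<and>
    call_M (c j) \<le> 2 * \<Lambda> \<and> \<tau>0 * 2 ^ j \<le> call_M (c j) * 4 ^ K \<and>
    F (call_x (c j)) + real K * (\<epsilon> powr (3 / 2) / (384 * sqrt (28 * \<Lambda> * real CARD('n))) * real CARD('n)) \<le> F x0"
  using large
proof (induction j)
  case 0
  show ?case
    using run x0 tau0 \<Lambda> by (intro exI[of _ 0]) (auto simp: cnm_run_def call_M_def)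
next
  case (Suc j)
  let ?n = "real CARD('n)"
  let ?D = "\<epsilon> powr (3 / 2) / (384 * sqrt (28 * \<Lambda> * ?n)) * ?n"
  have large_j: "\<And>t. 1 \<le> t \<Longrightarrow> t \<le> call_steps (c j) \<Longrightarrow> \<not> near_stationary grad \<psi> \<epsilon> (call_iter (c j) t)"
    using Suc.prems by auto
  obtain K where K: "call_x (c j) \<in> edom \<psi>" "\<tau>0 \<le> call_tau (c j)" "call_tau (c j) \<le> \<Lambda>"
      "call_M (c j) \<le> 2 * \<Lambda>" "\<tau>0 * 2 ^ j \<le> call_M (c j) * 4 ^ K"
      "F (call_x (c j)) + real K * ?D \<le> F x0"
    using Suc.IH Suc.prems by (meson less_SucI)
  have valid: "valid_call f \<psi> CARD('n) \<epsilon> (c j)" using run by (simp add: cnm_run_def)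
  note update = run[unfolded cnm_run_def, THEN conjunct2, THEN conjunct2, THEN conjunct2, THEN conjunct2,
      THEN spec, of j]
  have Mpos: "0 < call_M (c j)" using K tau0 by (simp add: call_M_def)
  show ?case
  proof (cases "call_result (c j)")
    case Halt
    have next_call: "call_x (c (Suc j)) = call_x (c j)" "call_tau (c (Suc j)) = call_tau (c j)"
        "call_ell (c (Suc j)) = Suc (call_ell (c j))"
      using update Halt by simp_all
    have M': "call_M (c (Suc j)) = 2 * call_M (c j)"
      by (simp add: call_M_def next_call)
    \<comment> \<open>Contrapositive of \<open>valid_call_succeeds\<close>; since
      \<open>L \<le> \<Lambda>\<close>, the doubled constant stays below
      \<open>2 * \<Lambda>\<close>.\<close>
    have "call_M (c j) < L"
      using valid_call_succeeds[OF valid fin K(1) eps Mpos _ large_j] Halt by fastforce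
    then show ?thesis
      using K \<Lambda> by (intro exI[of _ K]) (simp add: M' next_call)
  next
    case Success
    let ?y = "call_iter (c j)"
    have next_call: "call_x (c (Suc j)) = ?y (call_steps (c j))"
        "call_tau (c (Suc j)) = max \<tau>0 (2 ^ call_ell (c j) / 2 * call_tau (c j))"
        "call_ell (c (Suc j)) = 0"
      using update Success by simp_all
    have tau': "call_tau (c (Suc j)) = max \<tau>0 (call_M (c j) / 2)"
      by (simp add: next_call call_M_def)
    have M': "call_M (c (Suc j)) = max \<tau>0 (call_M (c j) / 2)"
      by (simp add: call_M_def[of "c (Suc j)"] tau' next_call(3))
    have n: "call_steps (c j) = CARD('n)"
      and steps: "\<And>t. t < CARD('n) \<Longrightarrow> \<exists>B. cubic_step f \<psi> B (call_sigma CARD('n) (c j)) CARD('n) \<epsilon> (?y t) (?y (Suc t))"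
      and dec: "\<And>t. t < CARD('n) \<Longrightarrow> sufficient_decrease f \<psi> (call_sigma CARD('n) (c j)) \<epsilon> (call_x (c j)) t (?y (Suc t))"
      using valid Success by (auto simp: valid_call_def cubic_steps_def)
    \<comment> \<open>Tests are indexed from 0, so the last one has index \<open>p\<close> and
      certifies the factor \<open>p + 1 = CARD('n)\<close>.\<close>
    obtain p where p: "CARD('n) = Suc p" using zero_less_card_finite[where 'a='n] by (cases "CARD('n)") auto
    have dom: "?y (CARD('n)) \<in> edom \<psi>"
      using steps[of p] p by (auto simp: cubic_step_def Let_def)
    \<comment> \<open>28 is the 14 of \<open>reg_param_bounds\<close> times the 2 of the invariant
      on \<open>call_M\<close>.\<close>
    have \<sigma>: "0 < call_sigma CARD('n) (c j)" "call_sigma CARD('n) (c j) \<le> 28 * \<Lambda> * ?n"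
    proof -
      have "0 < call_M (c j) * ?n" using Mpos by simp
      moreover have "call_M (c j) * ?n \<le> 2 * \<Lambda> * ?n" using K by (intro mult_right_mono) auto
      ultimately show "0 < call_sigma CARD('n) (c j)" "call_sigma CARD('n) (c j) \<le> 28 * \<Lambda> * ?n"
        using reg_param_bounds[of "call_M (c j)" "CARD('n)"] Mpos
        unfolding call_sigma_def mult.assoc by linarith+
    qed
    have dec_last: "sufficient_decrease f \<psi> (call_sigma CARD('n) (c j)) \<epsilon> (call_x (c j)) p (?y CARD('n))"
        and Suc_p: "p + 1 = CARD('n)"
      using dec[of p] p by simp_all
    have "?D \<le> \<epsilon> powr (3 / 2) / (384 * sqrt (call_sigma CARD('n) (c j))) * ?n"
      using \<sigma> by (intro mult_right_mono divide_left_mono) auto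
    also have "\<dots> \<le> F (call_x (c j)) - F (?y (CARD('n)))"
      using dec_last[unfolded sufficient_decrease_def Suc_p] objective_eq_ereal[OF K(1) fin] objective_eq_ereal[OF dom fin]
      by (simp add: F_def)
    finally have "F (?y (CARD('n))) + (real K + 1) * ?D \<le> F x0"
      using K(6) unfolding distrib_right by simp
    \<comment> \<open>The new factor 4 covers a 2 for the additional call and a 2 for the possible
      halving of \<open>call_M\<close>.\<close>
    moreover have "\<tau>0 * 2 ^ Suc j \<le> call_M (c (Suc j)) * 4 ^ Suc K"
    proof -
      have "call_M (c j) / 2 * 4 ^ Suc K \<le> call_M (c (Suc j)) * 4 ^ Suc K"
        by (intro mult_right_mono) (simp_all add: M')
      moreover have "\<tau>0 * 2 ^ Suc j \<le> call_M (c j) / 2 * 4 ^ Suc K" using K(5) by simp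
      ultimately show ?thesis by (rule order_trans[rotated])
    qed
    ultimately show ?thesis
      using K \<Lambda> tau0 dom
      by (intro exI[of _ "Suc K"] conjI) (simp_all add: next_call(1) tau' M' n add.commute)
  qed
qed

end

section \<open>Counting function evaluations\<close>

lemma size_call_queries:
  fixes c :: "(real ^ 'n) cnm_call"
  shows "size (call_queries m \<epsilon> c T) = 4 * CARD('n) ^ 2 + T * (2 * CARD('n) + 3)"
  by (simp add: call_queries_def hess_queries_def grad_queries_def power2_eq_square algebra_simps)

text \<open>The unfinished call \<open>j\<close> is charged as a complete one, hence the factor
  \<open>j + 1\<close>.\<close>

lemma evals_le:
  fixes c :: "nat \<Rightarrow> (real ^ 'n) cnm_call"
  assumes "\<And>i. call_steps (c i) \<le> CARD('n)" "t \<le> call_steps (c j)"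
  shows "evals m \<epsilon> c j t \<le> 9 * CARD('n) ^ 2 * (j + 1)"
proof -
  \<comment> \<open>The dimension is at least 1, so \<open>2 * CARD('n) + 3\<close> is at most 5
    times the dimension, and 4 + 5 = 9.\<close>
  have bound: "4 * CARD('n) ^ 2 + T * (2 * CARD('n) + 3) \<le> 9 * CARD('n) ^ 2" if "T \<le> CARD('n)" for T
  proof -
    have "T * (2 * CARD('n) + 3) \<le> CARD('n) * (2 * CARD('n) + 3 * CARD('n))"
      using that zero_less_card_finite[where 'a='n] by (intro mult_mono) auto
    then show ?thesis by (simp add: power2_eq_square)
  qed
  have "evals m \<epsilon> c j t = (\<Sum>i<j. 4 * CARD('n) ^ 2 + call_steps (c i) * (2 * CARD('n) + 3))
      + (4 * CARD('n) ^ 2 + t * (2 * CARD('n) + 3))"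
    unfolding evals_def size_union size_multiset_sum size_call_queries ..
  also have "\<dots> \<le> (\<Sum>i<j. 9 * CARD('n) ^ 2) + 9 * CARD('n) ^ 2"
    using assms by (intro add_mono sum_mono bound) (auto intro: order_trans)
  finally show ?thesis by (simp add: algebra_simps)
qed

lemma call_steps_le:
  assumes "valid_call f \<psi> m \<epsilon> c"
  shows "call_steps c \<le> m"
  using assms by (auto simp: valid_call_def cubic_steps_def split: outcome.splits)

lemma opt_value_finite:
  assumes "opt_value f \<psi> > -\<infinity>" "\<And>x. \<psi> x \<noteq> -\<infinity>" "x0 \<in> edom \<psi>"
  obtains Fs where "opt_value f \<psi> = ereal Fs"
    and "\<And>x. x \<in> edom \<psi> \<Longrightarrow> Fs \<le> f x + real_of_ereal (\<psi> x)"
proof -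
  have le: "opt_value f \<psi> \<le> ereal (f x + real_of_ereal (\<psi> x))" if "x \<in> edom \<psi>" for x
    unfolding opt_value_def objective_eq_ereal[OF that assms(2), symmetric]
    using that by (rule INF_lower)
  obtain Fs where "opt_value f \<psi> = ereal Fs"
    using assms(1) le[OF assms(3)] by (cases "opt_value f \<psi>") auto
  with le that show ?thesis by simp
qed

text \<open>Binary logarithm of the doubling invariant; each success accounts for two calls because
  \<open>4 = 2 ^ 2\<close>.\<close>

lemma index_bound_from_doubling:
  assumes "0 < \<tau>" "\<tau> * 2 ^ j \<le> 2 * \<Lambda> * 4 ^ K"
  shows "real j \<le> 2 * real K + 1 + log 2 (\<Lambda> / \<tau>)"
proof -
  have "0 < \<tau> * 2 ^ j" using assms by simp
  also note assms(2)
  finally have "0 < \<Lambda>" by (simp add: zero_less_mult_iff)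
  have "2 powr real j = 2 ^ j" by (simp add: powr_realpow)
  also have "\<dots> \<le> 2 * \<Lambda> / \<tau> * 4 ^ K" using assms by (simp add: field_simps)
  also have "\<dots> = 2 powr (2 * real K + 1 + log 2 (\<Lambda> / \<tau>))"
    using \<open>0 < \<Lambda>\<close> \<open>0 < \<tau>\<close>
    by (simp add: powr_add powr_mult_base powr_powr[symmetric] powr_realpow)
  finally show ?thesis by simp
qed

text \<open>\<open>real K * real n ^ 2\<close> is of order \<open>X\<close>, while halts and the
  current call contribute multiples of \<open>real n ^ 2\<close> independent of
  \<open>\<epsilon>\<close>. These are absorbed when \<open>real n ^ 2 \<le> X\<close>, which is the
  condition \<open>\<epsilon> \<le> real n powr (- 1 / 3)\<close>.\<close>

lemma complexity_arith:
  fixes \<epsilon> \<Delta> \<tau> L :: real and n :: nat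
  defines "\<Lambda> \<equiv> max \<tau> L"
  defines "X \<equiv> real n powr (3 / 2) * \<epsilon> powr (- 3 / 2)"
  assumes n: "0 < n" and eps: "0 < \<epsilon>" and tau: "0 < \<tau>" and \<Delta>: "0 \<le> \<Delta>"
    and K: "real K * (\<epsilon> powr (3 / 2) / (384 * sqrt (28 * \<Lambda> * real n)) * real n) \<le> \<Delta>"
    and j: "real j \<le> 2 * real K + 1 + log 2 (\<Lambda> / \<tau>)"
    and E: "E \<le> 9 * real n ^ 2 * (real j + 1)"
  shows "E \<le> complexity_const L \<tau> \<Delta> * (X + real n ^ 2)"
    and "\<epsilon> \<le> real n powr (- 1 / 3) \<Longrightarrow> E \<le> complexity_const L \<tau> \<Delta> * X"
proof -
  have \<Lambda>: "0 < \<Lambda>" "\<tau> \<le> \<Lambda>" using tau by (auto simp: \<Lambda>_def)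
  have lg: "0 \<le> log 2 (\<Lambda> / \<tau>)" using \<Lambda> tau by simp
  have X0: "0 \<le> X" by (simp add: X_def)
  have SX: "0 \<le> sqrt \<Lambda> * \<Delta> * X" using \<Lambda> \<Delta> X0 by simp
  have s28: "sqrt 28 \<le> 53 / 10" by (rule real_le_lsqrt) (simp_all add: power2_eq_square)
  have s0: "0 < sqrt (28 * \<Lambda> * real n)" using \<Lambda> n by simp
  have n32: "real n powr (3 / 2) = real n * sqrt (real n)"
    using n powr_add[of "real n" 1 "1 / 2"] by (simp add: powr_half_sqrt)
  have e32: "\<epsilon> powr (3 / 2) * \<epsilon> powr (- 3 / 2) = 1" using eps by (simp flip: powr_add)
  have "real K * (real n * \<epsilon> powr (3 / 2)) \<le> \<Delta> * (384 * sqrt (28 * \<Lambda> * real n))"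
    using K s0 by (simp add: field_simps)
  then have "real K * (real n * \<epsilon> powr (3 / 2)) * (real n * \<epsilon> powr (- 3 / 2))
      \<le> \<Delta> * (384 * sqrt (28 * \<Lambda> * real n)) * (real n * \<epsilon> powr (- 3 / 2))"
    by (intro mult_right_mono) auto
  also have "real K * (real n * \<epsilon> powr (3 / 2)) * (real n * \<epsilon> powr (- 3 / 2)) = real K * real n ^ 2"
    using e32 by (simp add: power2_eq_square algebra_simps)
  also have "\<Delta> * (384 * sqrt (28 * \<Lambda> * real n)) * (real n * \<epsilon> powr (- 3 / 2))
      = 384 * sqrt 28 * (sqrt \<Lambda> * \<Delta> * X)"
    by (simp add: X_def n32 real_sqrt_mult)
  also have "\<dots> \<le> 384 * (53 / 10) * (sqrt \<Lambda> * \<Delta> * X)"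
    using s28 \<Delta> \<Lambda> X0 by (intro mult_right_mono) auto
  \<comment> \<open>18 * 384 * 5.3 = 36633.6 is rounded up to 40000.\<close>
  finally have Kn: "18 * (real K * real n ^ 2) \<le> 40000 * (sqrt \<Lambda> * \<Delta> * X)"
    using SX by linarith
  have "E \<le> 9 * real n ^ 2 * (2 * real K + 2 + log 2 (\<Lambda> / \<tau>))"
    using E j by (elim order_trans) (intro mult_left_mono, auto)
  also have "\<dots> = 18 * (real K * real n ^ 2) + (18 + 9 * log 2 (\<Lambda> / \<tau>)) * real n ^ 2"
    by (simp add: algebra_simps)
  finally have E': "E \<le> 40000 * (sqrt \<Lambda> * \<Delta> * X) + (18 + 9 * log 2 (\<Lambda> / \<tau>)) * real n ^ 2"
    using Kn by linarith
  have C: "complexity_const L \<tau> \<Delta> = 40000 * sqrt \<Lambda> * \<Delta> + (18 + 9 * log 2 (\<Lambda> / \<tau>))"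
    by (simp add: complexity_const_def \<Lambda>_def)
  have nonneg: "0 \<le> 40000 * sqrt \<Lambda> * \<Delta> * real n ^ 2" "0 \<le> (18 + 9 * log 2 (\<Lambda> / \<tau>)) * X"
    using \<Delta> \<Lambda> lg X0 by auto
  show "E \<le> complexity_const L \<tau> \<Delta> * (X + real n ^ 2)"
    using E' nonneg unfolding C by (simp add: algebra_simps)
  show "E \<le> complexity_const L \<tau> \<Delta> * X" if small: "\<epsilon> \<le> real n powr (- 1 / 3)"
  proof -
    have "sqrt (real n) = (real n powr (- 1 / 3)) powr (- 3 / 2)"
      using n by (simp add: powr_powr powr_half_sqrt)
    also have "\<dots> \<le> \<epsilon> powr (- 3 / 2)"
      using small eps by (intro powr_mono2') auto
    finally have "real n powr (3 / 2) * sqrt (real n) \<le> X"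
      unfolding X_def by (intro mult_left_mono) auto
    then have "real n ^ 2 \<le> X" by (simp add: n32 power2_eq_square mult.assoc)
    then have "(18 + 9 * log 2 (\<Lambda> / \<tau>)) * real n ^ 2 \<le> (18 + 9 * log 2 (\<Lambda> / \<tau>)) * X"
      using lg by (intro mult_left_mono) auto
    with E' show ?thesis unfolding C by (simp add: algebra_simps)
  qed
qed

section \<open>The evaluation bound along a run\<close>

text \<open>A single Hessian estimate is already charged \<open>4 * CARD('n) ^ 2\<close>
  evaluations, which explains the additive \<open>n ^ 2\<close> when \<open>\<epsilon>\<close> is
  not small relative to the dimension. As the run never stops by itself, evaluations are counted up
  to a near-stationary iterate.\<close>

theorem corollary5p6:
  fixes f :: "real ^ 'n \<Rightarrow> real"
    and grad :: "real ^ 'n \<Rightarrow> real ^ 'n"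
    and hess :: "real ^ 'n \<Rightarrow> real ^ 'n ^ 'n"
    and \<psi> :: "real ^ 'n \<Rightarrow> ereal"
    and L \<tau>0 \<epsilon> :: real
    and x0 :: "real ^ 'n"
    and c :: "nat \<Rightarrow> (real ^ 'n) cnm_call"
  assumes grad: "\<And>x. GDERIV f x :> grad x"
    and hess: "\<And>x. (grad has_derivative (\<lambda>v. hess x *v v)) (at x)"
    and hess_cont: "continuous_on UNIV hess"
    and psi: "proper_closed_convex \<psi>"
    and bounded_below: "opt_value f \<psi> > -\<infinity>"
    and L: "L \<ge> 0"
    and A1: "\<And>x y. spectral_norm (hess y - hess x) \<le> L * norm (y - x)"
    and x0: "x0 \<in> edom \<psi>"
    and tau0: "\<tau>0 > 0"
    and eps: "\<epsilon> > 0"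
    and run: "cnm_run f \<psi> x0 \<tau>0 CARD('n) \<epsilon> c"
  defines "n \<equiv> real CARD('n)"
    and "C \<equiv> complexity_const L \<tau>0 (real_of_ereal (objective f \<psi> x0 - opt_value f \<psi>))"
  shows "\<exists>j t xbar. 1 \<le> t \<and> t \<le> call_steps (c j) \<and> xbar = call_iter (c j) t \<and>
           (\<exists>s\<in>subdiff \<psi> xbar. norm (grad xbar + s) \<le> \<epsilon>) \<and>
           (\<epsilon> \<le> n powr (- 1 / 3) \<longrightarrow>
              real (evals CARD('n) \<epsilon> c j t) \<le> C * (n powr (3 / 2) * \<epsilon> powr (- 3 / 2))) \<and>
           real (evals CARD('n) \<epsilon> c j t) \<le> C * (n powr (3 / 2) * \<epsilon> powr (- 3 / 2) + n ^ 2)"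
proof -
  interpret lipschitz_hessian f grad hess L
  proof
    show "norm ((hess y - hess x) *v v) \<le> L * norm (y - x) * norm v" for x y v
      using onorm[OF matrix_vector_mul_bounded_linear, of "hess y - hess x" v]
        mult_right_mono[OF A1[of y x] norm_ge_zero[of v]]
      unfolding spectral_norm_def by linarith
  qed (use grad hess L in auto)
  let ?F = "\<lambda>x. f x + real_of_ereal (\<psi> x)"
  define \<Lambda> where "\<Lambda> = max \<tau>0 L"
  define D where "D = \<epsilon> powr (3 / 2) / (384 * sqrt (28 * \<Lambda> * n)) * n"
  have fin: "\<psi> x \<noteq> -\<infinity>" for x using psi by (simp add: proper_closed_convex_def)
  obtain Fs where Fs: "opt_value f \<psi> = ereal Fs" "\<And>x. x \<in> edom \<psi> \<Longrightarrow> Fs \<le> ?F x"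
    using opt_value_finite[OF bounded_below fin x0] by blast
  have \<Delta>: "real_of_ereal (objective f \<psi> x0 - opt_value f \<psi>) = ?F x0 - Fs"
    by (simp add: Fs objective_eq_ereal[OF x0 fin])
  have "0 < n" "0 < \<Lambda>" using tau0 by (auto simp: n_def \<Lambda>_def)
  then have "0 < D" using eps by (simp add: D_def)
  let ?good = "\<lambda>j. \<exists>t. 1 \<le> t \<and> t \<le> call_steps (c j) \<and> near_stationary grad \<psi> \<epsilon> (call_iter (c j) t)"
  \<comment> \<open>Before the first good call, the gap \<open>?F x0 - Fs\<close> limits the
    successes \<open>K\<close>, and \<open>K\<close> limits the number of calls.\<close>
  have index_bound: "\<exists>K. real K * D \<le> ?F x0 - Fs \<and> real j \<le> 2 * real K + 1 + log 2 (\<Lambda> / \<tau>0)"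
    if "\<And>i. i < j \<Longrightarrow> \<not> ?good i" for j
  proof -
    have "\<tau>0 \<le> \<Lambda>" "L \<le> \<Lambda>" by (auto simp: \<Lambda>_def)
    from cnm_run_invariant[OF run fin x0 tau0 eps this, of j] that
    obtain K where K: "call_x (c j) \<in> edom \<psi>" "call_M (c j) \<le> 2 * \<Lambda>"
        "\<tau>0 * 2 ^ j \<le> call_M (c j) * 4 ^ K" "?F (call_x (c j)) + real K * D \<le> ?F x0"
      unfolding D_def n_def by blast
    have "call_M (c j) * 4 ^ K \<le> 2 * \<Lambda> * 4 ^ K" using K(2) by (intro mult_right_mono) auto
    with K(3) have "real j \<le> 2 * real K + 1 + log 2 (\<Lambda> / \<tau>0)"
      by (intro index_bound_from_doubling tau0) linarith
    with K(4) Fs(2)[OF K(1)] show ?thesis by (intro exI[of _ K]) linarith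
  qed
  have "\<exists>j. ?good j"
  \<comment> \<open>Otherwise \<open>index_bound\<close> would hold for every \<open>j\<close>, with
    \<open>K\<close> at most the gap divided by \<open>D\<close>, although \<open>j\<close> is
    unbounded.\<close>
  proof (rule ccontr)
    assume never: "\<nexists>j. ?good j"
    obtain j :: nat where j: "2 * ((?F x0 - Fs) / D) + 1 + log 2 (\<Lambda> / \<tau>0) < real j"
      using reals_Archimedean2 by blast
    obtain K where K: "real K * D \<le> ?F x0 - Fs" "real j \<le> 2 * real K + 1 + log 2 (\<Lambda> / \<tau>0)"
      using index_bound[of j] never by blast
    have "real K \<le> (?F x0 - Fs) / D" using K(1) \<open>0 < D\<close> by (simp add: field_simps)
    with K(2) j show False by linarith
  qed
  \<comment> \<open>Minimality of \<open>j\<close> makes \<open>index_bound\<close> applicable. Any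
    suitable \<open>t\<close> in call \<open>j\<close> will do, since that call is charged in
    full.\<close>
  then obtain j where j: "?good j" "\<And>i. i < j \<Longrightarrow> \<not> ?good i"
    using exists_least_iff[of ?good] by blast
  then obtain t where t: "1 \<le> t" "t \<le> call_steps (c j)" "near_stationary grad \<psi> \<epsilon> (call_iter (c j) t)"
    by blast
  obtain K where K: "real K * D \<le> ?F x0 - Fs" "real j \<le> 2 * real K + 1 + log 2 (\<Lambda> / \<tau>0)"
    using index_bound[OF j(2)] by blast
  have "call_steps (c i) \<le> CARD('n)" for i
    using run by (intro call_steps_le[of f \<psi> _ \<epsilon>]) (simp add: cnm_run_def)
  from evals_le[where c = c, OF this t(2), of "CARD('n)" \<epsilon>]
  have "real (evals CARD('n) \<epsilon> c j t) \<le> real (9 * CARD('n) ^ 2 * (j + 1))"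
    unfolding of_nat_le_iff .
  then have E: "real (evals CARD('n) \<epsilon> c j t) \<le> 9 * n ^ 2 * (real j + 1)"
    by (simp add: n_def algebra_simps)
  have "0 \<le> ?F x0 - Fs" using Fs(2)[OF x0] by simp
  note bounds = complexity_arith[of "CARD('n)" \<epsilon> \<tau>0 "?F x0 - Fs" K L j, folded n_def \<Lambda>_def,
      folded D_def, OF _ eps tau0 this K E]
  have "0 < CARD('n)" by simp
  from bounds[OF this] t show ?thesis
    unfolding C_def \<Delta> near_stationary_def by blast
qed

end
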